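(* Let $G$ be a regular dense-subgroup-separable paratopological abelian group with $|G|>1$. If $G$ is bounded, then the following conditions are equivalent: (1) $G$ is $d$-independent; (2) $G$ is a nontrivial $M$-group; (3) each nontrivial primary component $G_{p}$ of $G$ is $d$-independent.
   Context: All spaces are Hausdorff; $\mathfrak{c}=|\mathbb{R}|$; $e$ is the neutral element (additive notation). A paratopological group is a group with a topology for which the group operation is jointly continuous. Such a group is dense-subgroup-separable if each of its dense subgroups is separable. A nontrivial such group $G$ is $d$-independent if for every subgroup $S$ of $G$ with $|S|<\mathfrak{c}$ there is a countable dense subgroup $H$ of $G$ with $S\cap H=\{e\}$. An abelian group $G$ is bounded if there is a positive integer $m$ with $mg=e$ for all $g\in G$. For a prime $p$, the primary component $G_p$ is the subgroup of all elements of $G$ whose order is a power of $p$, with the subspace topology. A subset of an abstract group $G$ is unconditionally closed if it is closed in every Hausdorff topological group topology on $G$; $G$ is an $M$-group if each proper unconditionally closed subgroup of $G$ has index at least $\mathfrak{c}$. (For abelian $G$ it is known that this is equivalent to: for every integer $m\geq 1$, either $|mG|=1$ or $|mG|\geq\mathfrak{c}$, where $mG=\{mg:g\in G\}$.) *)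

theory Defs
  imports
    "HOL-Analysis.Analysis"
    "HOL-Algebra.Elementary_Groups"
    "HOL-Algebra.Multiplicative_Group"
    "HOL-Computational_Algebra.Primes"
begin

text \<open>
  Groups are those of HOL-Algebra, hence written multiplicatively, and a topology on a group is a
  topology in the sense of \<^typ>\<open>'a topology\<close> whose underlying set is the carrier. No separation axiom
  is built into the two notions of group with topology below; the Hausdorff property is
  stated explicitly where it is needed (and \<^const>\<open>regular_space\<close> does not include it).
\<close>

definition paratopological_group :: "('a, 'b) monoid_scheme \<Rightarrow> 'a topology \<Rightarrow> bool" where
  "paratopological_group G T \<longleftrightarrow>
     group G \<and> topspace T = carrier G \<and>
     continuous_map (prod_topology T T) T (\<lambda>(x, y). x \<otimes>\<^bsub>G\<^esub> y)"

definition topological_group :: "('a, 'b) monoid_scheme \<Rightarrow> 'a topology \<Rightarrow> bool" where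
  "topological_group G T \<longleftrightarrow>
     paratopological_group G T \<and> continuous_map T T (\<lambda>x. inv\<^bsub>G\<^esub> x)"

definition dense_subgroup :: "('a, 'b) monoid_scheme \<Rightarrow> 'a topology \<Rightarrow> 'a set \<Rightarrow> bool" where
  "dense_subgroup G T H \<longleftrightarrow> subgroup H G \<and> T closure_of H = topspace T"

definition dense_subgroup_separable :: "('a, 'b) monoid_scheme \<Rightarrow> 'a topology \<Rightarrow> bool" where
  "dense_subgroup_separable G T \<longleftrightarrow>
     (\<forall>H. dense_subgroup G T H \<longrightarrow> separable_space (subtopology T H))"

definition d_independent :: "('a, 'b) monoid_scheme \<Rightarrow> 'a topology \<Rightarrow> bool" where
  "d_independent G T \<longleftrightarrow>
     paratopological_group G T \<and> \<not> trivial_group G \<and>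
     (\<forall>S. subgroup S G \<and> S \<prec> (UNIV :: real set) \<longrightarrow>
        (\<exists>H. dense_subgroup G T H \<and> countable H \<and> S \<inter> H = {\<one>\<^bsub>G\<^esub>}))"

definition bounded_group :: "('a, 'b) monoid_scheme \<Rightarrow> bool" where
  "bounded_group G \<longleftrightarrow> (\<exists>m::nat. m > 0 \<and> (\<forall>g\<in>carrier G. g [^]\<^bsub>G\<^esub> m = \<one>\<^bsub>G\<^esub>))"

text \<open>\<^const>\<open>group.ord\<close> is 0 on elements of infinite order, so these are excluded.\<close>

definition primary_component :: "('a, 'b) monoid_scheme \<Rightarrow> nat \<Rightarrow> 'a set" where
  "primary_component G p = {g \<in> carrier G. \<exists>k::nat. group.ord G g = p ^ k}"

definition unconditionally_closed :: "('a, 'b) monoid_scheme \<Rightarrow> 'a set \<Rightarrow> bool" where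
  "unconditionally_closed G A \<longleftrightarrow>
     A \<subseteq> carrier G \<and> (\<forall>T. topological_group G T \<and> Hausdorff_space T \<longrightarrow> closedin T A)"

definition M_group :: "('a, 'b) monoid_scheme \<Rightarrow> bool" where
  "M_group G \<longleftrightarrow>
     group G \<and>
     (\<forall>H. subgroup H G \<and> H \<noteq> carrier G \<and> unconditionally_closed G H \<longrightarrow>
        (UNIV :: real set) \<lesssim> rcosets\<^bsub>G\<^esub> H)"

end

theory Submission
  imports Defs
begin

text \<open>
  The explanations here and below write groups additively. All three conditions turn out to be
  equivalent to one algebraic condition, called \<open>power_images_large\<close> below: for every \<open>m\<close> the
  subgroup \<open>mG\<close> is trivial or has at least \<open>c\<close> elements, where \<open>c\<close> is the cardinality of the reals.
  Let \<open>N\<close> be the exponent of \<open>G\<close>. Since the inverse of \<open>x\<close> is \<open>(N-1)x\<close>, continuity of addition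
  makes inversion continuous, and \<open>G\<close> is a topological group.

  Necessity is short. The \<open>m\<close>-torsion subgroup is closed in every Hausdorff group topology, and
  its index is the size of \<open>mG\<close>; hence an M-group satisfies the condition. If \<open>G\<close> is
  \<open>d\<close>-independent and \<open>mG\<close> is smaller than \<open>c\<close>, a dense subgroup \<open>D\<close> that meets \<open>mG\<close> trivially
  satisfies \<open>mD = 0\<close>, so the closed \<open>m\<close>-torsion subgroup is all of \<open>G\<close>.

  The condition makes \<open>G\<close> an M-group (\<open>power_images_large_imp_M_group\<close>). Let \<open>H\<close> be a proper
  subgroup of index less than \<open>c\<close>, and let \<open>a\<close> outside \<open>H\<close> have the least possible order \<open>n\<close>,
  which is then a power of a prime \<open>p\<close>. As \<open>(N/p)H\<close> must be of size at least \<open>c\<close>, the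
  subgroup \<open>H\<close> contains a sequence of elements \<open>h\<^sub>i\<close> of order \<open>n\<close> that is independent modulo the
  cyclic group of \<open>a\<close>. The subgroups generated by the tails of the sequence \<open>h\<^sub>i - a\<close> intersect
  trivially, so they form a base at the neutral element of a Hausdorff group topology. In it
  \<open>h\<^sub>i\<close> converges to \<open>a\<close>, so \<open>H\<close> is not closed.

  The condition makes \<open>G\<close> \<open>d\<close>-independent (\<open>power_images_large_imp_d_independent\<close>). A regular
  separable space has a base of at most \<open>c\<close> open sets. Given a subgroup \<open>S\<close> of size less than
  \<open>c\<close>, transfinite recursion picks in each nonempty basic open set a point of order \<open>N\<close> whose
  cyclic group meets the subgroup generated by \<open>S\<close> and the earlier points trivially. This is
  possible because \<open>G\<close> is covered by countably many translates of a neighbourhood \<open>V\<close> of the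
  neutral element, so that a homomorphism with an image of size at least \<open>c\<close> cannot map \<open>V\<close> onto
  fewer than \<open>c\<close> elements. The points generate a dense subgroup that meets \<open>S\<close> trivially, and
  dense-subgroup-separability provides a countable dense subgroup inside it.

  For the primary components, \<open>d\<close>-independence passes from \<open>G\<close> to \<open>G\<^sub>p\<close> because multiplication by
  a suitable integer is a continuous retraction of \<open>G\<close> onto \<open>G\<^sub>p\<close> that preserves every subgroup.
  In the other direction, each nontrivial \<open>G\<^sub>p\<close> satisfies the algebraic condition by the necessity
  part, and then so does \<open>G\<close>, because a nontrivial \<open>mG\<close> contains a nontrivial \<open>mG\<^sub>p\<close>.
\<close>

section \<open>Cardinalities below an uncountable cardinal\<close>

lemma lepoll_iff_ordLeq: "A \<lesssim> B \<longleftrightarrow> (card_of A, card_of B) \<in> ordLeq"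
  by (simp add: lepoll_def card_of_ordLeq)

lemma lesspoll_iff_not_lepoll: "A \<prec> B \<longleftrightarrow> \<not> B \<lesssim> A"
proof -
  have "A \<lesssim> B \<or> B \<lesssim> A"
    using ordLeq_total[OF card_of_Well_order card_of_Well_order]
    by (auto simp: lepoll_iff_ordLeq)
  then show ?thesis
    by (meson lesspoll_def eqpoll_imp_lepoll eqpoll_sym lepoll_antisym)
qed

lemma lesspoll_iff_ordLess: "A \<prec> B \<longleftrightarrow> (card_of A, card_of B) \<in> ordLess"
  by (metis card_of_Well_order lepoll_iff_ordLeq lesspoll_iff_not_lepoll not_ordLeq_iff_ordLess)

lemma Times_lepoll_infinite:
  assumes "infinite C" "A \<lesssim> C" "B \<lesssim> C"
  shows "A \<times> B \<lesssim> C"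
proof -
  have "A \<times> B \<lesssim> C \<times> C"
    using assms(2,3) by (rule times_lepoll_mono)
  also have "C \<times> C \<approx> C"
    using card_of_Times_same_infinite[OF assms(1)] by (simp add: eqpoll_iff_card_of_ordIso)
  finally show ?thesis .
qed

lemma lepoll_two_cases:
  obtains "A \<lesssim> B" | "B \<lesssim> A"
  using lesspoll_iff_not_lepoll lesspoll_imp_lepoll by blast

lemma countable_imp_lesspoll_reals:
  assumes "countable A" shows "A \<prec> (UNIV :: real set)"
  using assms countable_lepoll lesspoll_iff_not_lepoll uncountable_UNIV_real by blast

lemma Un_lesspoll_infinite:
  assumes "A \<prec> C" "B \<prec> C" "infinite C"
  shows "A \<union> B \<prec> C"
proof (cases "finite A \<and> finite B")
  case True
  then show ?thesis using assms(3) by (simp add: finite_lesspoll_infinite)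
next
  case False
  have *: "A \<union> B \<prec> C" if "A \<lesssim> B" "infinite B" "B \<prec> C" for A B
  proof -
    have "\<Union>(id ` {A, B}) \<lesssim> B"
      using card_of_UNION_ordLeq_infinite[of B "{A,B}" id] that
      by (auto simp: lepoll_iff_ordLeq[symmetric] intro: finite_lepoll_infinite)
    then show ?thesis using that(3) lesspoll_trans1 by force
  qed
  consider "A \<lesssim> B" | "B \<lesssim> A"
    by (rule lepoll_two_cases)
  then show ?thesis
  proof cases
    case 1
    then show ?thesis using *[OF 1] assms False finite_lepoll_infinite
      by (metis (no_types, lifting) eqpoll_finite_iff lepoll_iff finite_surj)
  next
    case 2
    then show ?thesis using *[OF 2] assms False
      by (metis (no_types, lifting) Un_commute lepoll_iff finite_surj)
  qed
qed

lemma Times_lesspoll_infinite: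
  assumes "A \<prec> C" "B \<prec> C" "infinite C"
  shows "A \<times> B \<prec> C"
proof (cases "finite A \<and> finite B")
  case True
  then show ?thesis using assms(3) by (simp add: finite_lesspoll_infinite)
next
  case False
  consider "A \<lesssim> B" | "B \<lesssim> A"
    by (rule lepoll_two_cases)
  then show ?thesis
  proof cases
    case 1
    then have "infinite B" using False by (metis finite_surj lepoll_iff)
    then have "A \<times> B \<lesssim> B" using 1 by (intro Times_lepoll_infinite) auto
    then show ?thesis using assms(2) lesspoll_trans1 by blast
  next
    case 2
    then have "infinite A" using False by (metis finite_surj lepoll_iff)
    then have "A \<times> B \<lesssim> A" using 2 by (intro Times_lepoll_infinite) auto
    then show ?thesis using assms(1) lesspoll_trans1 by blast
  qed
qed

text \<open>There are countably many lengths, and the lists of each length embed into a finite power of \<open>A\<close>,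
  which has the size of \<open>A\<close>.\<close>
lemma lists_lepoll_infinite:
  assumes "infinite A" shows "lists A \<lesssim> A"
proof -
  have *: "{xs \<in> lists A. length xs = n} \<lesssim> A" for n
  proof (induction n)
    case 0
    have "{xs \<in> lists A. length xs = 0} = {[]}" by auto
    then show ?case using assms by (simp add: finite_lepoll_infinite)
  next
    case (Suc n)
    have "{xs \<in> lists A. length xs = Suc n}
        \<subseteq> (\<lambda>(x, xs). x # xs) ` (A \<times> {xs \<in> lists A. length xs = n})"
      by (auto simp: length_Suc_conv image_iff)
    then have "{xs \<in> lists A. length xs = Suc n} \<lesssim> A \<times> {xs \<in> lists A. length xs = n}"
      by (rule subset_image_lepoll)
    also have "\<dots> \<lesssim> A"
      using Suc assms by (intro Times_lepoll_infinite) auto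
    finally show ?case .
  qed
  have "lists A = (\<Union>n\<in>(UNIV :: nat set). {xs \<in> lists A. length xs = n})"
    by auto
  also have "\<dots> \<lesssim> A"
    using card_of_UNION_ordLeq_infinite[OF assms] * infinite_le_lepoll assms
    by (metis (no_types, lifting) lepoll_iff_ordLeq)
  finally show ?thesis .
qed

lemma lists_lesspoll_uncountable:
  assumes "A \<prec> C" "uncountable C"
  shows "lists A \<prec> C"
proof (cases "finite A")
  case True
  then have "countable (lists A)" by (simp add: countable_finite)
  then show ?thesis using assms(2) countable_lepoll lesspoll_iff_not_lepoll by blast
next
  case False
  then show ?thesis using assms(1) lists_lepoll_infinite lesspoll_trans1 by blast
qed

lemma image_lesspoll: "A \<prec> C \<Longrightarrow> f ` A \<prec> C"
  using image_lepoll lesspoll_trans1 by blast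

text \<open>Every element of the generated subgroup is the value of a word in the generators and their
  inverses.\<close>
lemma (in group) generate_lepoll_lists:
  assumes "A \<subseteq> carrier G"
  shows "generate G A \<lesssim> lists (A \<union> (\<lambda>x. inv x) ` A)"
proof -
  define B where "B = A \<union> (\<lambda>x. inv x) ` A"
  have B: "B \<subseteq> carrier G" using assms by (auto simp: B_def)
  define w where "w xs = foldr (\<otimes>) xs \<one>" for xs
  have closed: "w xs \<in> carrier G" if "xs \<in> lists B" for xs
    using that B by (induction xs) (auto simp: w_def)
  have append: "w (xs @ ys) = w xs \<otimes> w ys" if "xs \<in> lists B" "ys \<in> lists B" for xs ys
    using that
  proof (induction xs)
    case Nil
    then show ?case using closed by (simp add: w_def)
  next
    case (Cons x xs)
    then have "x \<in> carrier G" "w xs \<in> carrier G" "w ys \<in> carrier G"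
      using closed B by auto
    then show ?case using Cons by (simp add: w_def m_assoc)
  qed
  have "x \<in> w ` lists B" if "x \<in> generate G A" for x
    using that
  proof (induction rule: generate.induct)
    case one
    show ?case by (rule image_eqI[of _ _ "[]"]) (auto simp: w_def)
  next
    case (incl h)
    then show ?case using assms
      by (intro image_eqI[of _ _ "[h]"]) (auto simp: w_def B_def)
  next
    case (inv h)
    then show ?case using assms
      by (intro image_eqI[of _ _ "[inv h]"]) (auto simp: w_def B_def)
  next
    case (eng h1 h2)
    then obtain xs ys where "xs \<in> lists B" "ys \<in> lists B" "h1 = w xs" "h2 = w ys"
      by blast
    then show ?case by (intro image_eqI[of _ _ "xs @ ys"]) (auto simp: append)
  qed
  then have "generate G A \<subseteq> w ` lists B" by blast
  then show ?thesis unfolding B_def by (rule subset_image_lepoll)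
qed

lemma (in group) countable_generate:
  assumes "countable A" "A \<subseteq> carrier G"
  shows "countable (generate G A)"
proof (rule countable_lepoll[OF _ generate_lepoll_lists[OF assms(2)]])
  show "countable (lists (A \<union> (\<lambda>x. inv x) ` A))"
    using assms(1) by (intro countable_lists countable_Un countable_image)
qed

lemma (in group) generate_lesspoll_uncountable:
  assumes "A \<prec> C" "uncountable C" "A \<subseteq> carrier G"
  shows "generate G A \<prec> C"
proof -
  have "A \<union> (\<lambda>x. inv x) ` A \<prec> C"
    using assms(1,2) by (intro Un_lesspoll_infinite image_lesspoll) (auto dest: countable_finite)
  then show ?thesis
    using generate_lepoll_lists[OF assms(3)] lists_lesspoll_uncountable[OF _ assms(2)] lesspoll_trans1
    by blast
qed

text \<open>Transfinite recursion along a well-order of the reals of minimal type, in which every proper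
  initial segment has fewer than continuum many elements. Whatever can be chosen against so few
  previous choices can therefore be chosen for all reals.\<close>
lemma real_indexed_choice:
  fixes Q :: "real \<Rightarrow> 'a set \<Rightarrow> 'a \<Rightarrow> bool"
  assumes "\<And>i X. X \<prec> (UNIV :: real set) \<Longrightarrow> \<exists>x. Q i X x"
  shows "\<exists>r f. well_order_on UNIV r \<and> (\<forall>i. Q i (f ` underS r i) (f i))"
proof -
  define r where "r = card_of (UNIV :: real set)"
  have card: "Card_order r" and field: "Field r = UNIV"
    unfolding r_def by (rule card_of_Card_order, rule Field_card_of)
  have wo: "well_order_on UNIV r"
    unfolding r_def by (rule card_of_well_order_on)
  have wf: "wf (r - Id)"
    using wo by (simp add: well_order_on_def)
  have in_r: "(j, i) \<in> r - Id" if "j \<in> underS r i" for i j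
    using that by (auto simp: underS_def)
  define H where "H = (\<lambda>(g :: real \<Rightarrow> 'a) i. SOME x. Q i (g ` underS r i) x)"
  define f where "f = wfrec (r - Id) H"
  have "adm_wf (r - Id) H"
    unfolding adm_wf_def
  proof (intro allI impI)
    fix g g' :: "real \<Rightarrow> 'a" and i
    assume "\<forall>j. (j, i) \<in> r - Id \<longrightarrow> g j = g' j"
    then have "g ` underS r i = g' ` underS r i"
      using in_r by (intro image_cong) auto
    then show "H g i = H g' i" by (simp add: H_def)
  qed
  then have f: "f i = H f i" for i
    unfolding f_def by (rule wfrec_fixpoint[OF wf, THEN fun_cong])
  have "Q i (f ` underS r i) (f i)" for i
  proof -
    have "(card_of (underS r i), r) \<in> ordLess"
      using card field by (simp add: card_of_underS)
    then have "f ` underS r i \<prec> (UNIV :: real set)"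
      by (intro image_lesspoll) (simp add: lesspoll_iff_ordLess r_def)
    then show ?thesis
      unfolding f[of i] H_def by (rule someI_ex[OF assms])
  qed
  then show ?thesis using wo by blast
qed

section \<open>Independent families\<close>

lemma (in comm_group) finprod_in_subgroup:
  assumes "subgroup P G" "\<And>i. i \<in> F \<Longrightarrow> g i \<in> P"
  shows "finprod G g F \<in> P"
  using assms(2)
proof (induction F rule: infinite_finite_induct)
  case (infinite A)
  then show ?case using assms(1) by (simp add: subgroup.one_closed)
next
  case empty
  then show ?case using assms(1) by (simp add: subgroup.one_closed)
next
  case (insert i F)
  have "g \<in> F \<rightarrow> carrier G" "g i \<in> carrier G"
    using insert.prems subgroup.mem_carrier[OF assms(1)] by auto
  then show ?case using insert assms(1) by (simp add: subgroup.m_closed)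
qed

lemma (in comm_group) generate_image_finprod:
  assumes "x \<in> generate G (f ` I)" "\<And>i. i \<in> I \<Longrightarrow> f i \<in> carrier G"
  obtains F and c :: "'i \<Rightarrow> int" where "finite F" "F \<subseteq> I" "x = (\<Otimes>i\<in>F. f i [^] c i)"
proof -
  have "\<exists>F c. finite F \<and> F \<subseteq> I \<and> x = (\<Otimes>i\<in>F. f i [^] (c i :: int))"
    using assms(1)
  proof (induction rule: generate.induct)
    case one
    then show ?case by (intro exI[of _ "{}"]) auto
  next
    case (incl h)
    then obtain i where "i \<in> I" "h = f i" by blast
    then show ?case using assms(2)
      by (intro exI[of _ "{i}"] exI[of _ "\<lambda>_. 1"]) simp
  next
    case (inv h)
    then obtain i where "i \<in> I" "h = f i" by blast
    then show ?case using assms(2)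
      by (intro exI[of _ "{i}"] exI[of _ "\<lambda>_. -1"]) (simp add: int_pow_neg)
  next
    case (eng x y)
    then obtain F c F' c' where *: "finite F" "F \<subseteq> I" "x = (\<Otimes>i\<in>F. f i [^] (c i :: int))"
      "finite F'" "F' \<subseteq> I" "y = (\<Otimes>i\<in>F'. f i [^] (c' i :: int))"
      by blast
    define d where "d i = (if i \<in> F then c i else 0)" for i
    define d' where "d' i = (if i \<in> F' then c' i else 0)" for i
    have car: "f i \<in> carrier G" if "i \<in> F \<union> F'" for i
      using that * assms(2) by auto
    have "x = (\<Otimes>i\<in>F \<union> F'. f i [^] d i)"
      unfolding *(3) by (rule finprod_mono_neutral_cong_left) (use * car in \<open>auto simp: d_def\<close>)
    moreover have "y = (\<Otimes>i\<in>F \<union> F'. f i [^] d' i)"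
      unfolding *(6) by (rule finprod_mono_neutral_cong_left) (use * car in \<open>auto simp: d'_def\<close>)
    ultimately have "x \<otimes> y = (\<Otimes>i\<in>F \<union> F'. f i [^] d i \<otimes> f i [^] d' i)"
      using car by (subst finprod_multf) auto
    also have "\<dots> = (\<Otimes>i\<in>F \<union> F'. f i [^] (d i + d' i))"
      using car by (intro finprod_cong) (auto simp: int_pow_mult)
    finally show ?case using * by (intro exI[of _ "F \<union> F'"] exI[of _ "\<lambda>i. d i + d' i"]) auto
  qed
  then show thesis using that by blast
qed

text \<open>The criterion by which independence is checked: to keep the cyclic group of \<open>x\<close> apart from \<open>P\<close>
  it is enough to watch the finitely many multiples \<open>(n/p)x\<close>. If \<open>P\<close> contains \<open>zx\<close>, then by
  Bezout it contains \<open>dx\<close> for \<open>d = gcd(z, n)\<close>, and a proper divisor \<open>d\<close> of \<open>n\<close> divides \<open>n/p\<close> for some prime \<open>p\<close>.\<close>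
lemma (in group) dvd_exponent_if_pow_in_subgroup:
  assumes "x \<in> carrier G" "x [^] n = \<one>" "subgroup P G"
    and "\<And>p. prime p \<Longrightarrow> p dvd n \<Longrightarrow> x [^] (n div p) \<notin> P"
    and "x [^] (z :: int) \<in> P" "n > (0 :: nat)"
  shows "int n dvd z"
proof -
  define d where "d = nat (gcd z (int n))"
  have d: "int d = gcd z (int n)" by (simp add: d_def)
  then have "d dvd n" by (metis gcd_dvd2 int_dvd_int_iff)
  then obtain k where k: "n = d * k" by blast
  obtain u v where uv: "u * z + v * int n = int d"
    using bezout_int d by metis
  have "x [^] int n = \<one>" using assms(2) by (simp add: int_pow_int)
  then have "x [^] (int n * v) = \<one>" using assms(1)
    by (metis int_pow_one int_pow_pow)
  then have "x [^] int d = (x [^] z) [^] u"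
    using assms(1) unfolding uv[symmetric] by (simp add: int_pow_mult int_pow_pow mult.commute)
  then have xd: "x [^] d \<in> P"
    using subgroup_int_pow_closed[OF assms(3,5)] by (simp add: int_pow_int)
  have "k = 1"
  proof (rule ccontr)
    assume "k \<noteq> 1"
    then obtain p where p: "prime p" "p dvd k" using prime_factor_nat by blast
    then obtain l where l: "k = p * l" by blast
    have "n div p = d * l" using k l p(1) prime_gt_0_nat[of p] by simp
    moreover have "x [^] (d * l) \<in> P"
      using subgroup_int_pow_closed[OF assms(3) xd, of "int l"] assms(1)
      by (simp add: int_pow_int nat_pow_pow)
    ultimately show False using assms(4) p k by (metis dvd_mult)
  qed
  then have "int n = gcd z (int n)" using k d by simp
  then show ?thesis by (metis gcd_dvd1)
qed

lemma (in group) int_pow_eq_one_if_dvd: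
  assumes "x \<in> carrier G" "x [^] (n :: nat) = \<one>" "int n dvd z"
  shows "x [^] z = \<one>"
  using assms by (metis dvd_def int_pow_int int_pow_one int_pow_pow)

text \<open>For \<open>S\<close> the trivial subgroup and all \<open>f i\<close> of order \<open>n\<close> this says that the cyclic subgroups
  generated by the \<open>f i\<close> form a direct sum.\<close>
definition independent_over :: "('a, 'b) monoid_scheme \<Rightarrow> 'a set \<Rightarrow> nat \<Rightarrow> ('i \<Rightarrow> 'a) \<Rightarrow> bool" where
  "independent_over G S n f \<longleftrightarrow>
     (\<forall>F (c :: 'i \<Rightarrow> int). finite F \<and> (\<Otimes>\<^bsub>G\<^esub>i\<in>F. f i [^]\<^bsub>G\<^esub> c i) \<in> S \<longrightarrow> (\<forall>i\<in>F. int n dvd c i))"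

lemma well_order_finite_max:
  assumes "well_order_on UNIV r" "finite F" "F \<noteq> {}"
  obtains m where "m \<in> F" "\<And>i. i \<in> F \<Longrightarrow> i \<noteq> m \<Longrightarrow> i \<in> underS r m"
proof -
  have r: "refl r" "trans r" "total r"
    using assms(1) by (auto simp: well_order_on_def linear_order_on_def partial_order_on_def preorder_on_def)
  have "\<exists>m\<in>F. \<forall>i\<in>F. (i, m) \<in> r"
    using assms(2,3)
  proof (induction rule: finite_ne_induct)
    case (singleton x)
    then show ?case using r(1) by (auto simp: refl_on_def)
  next
    case (insert x F)
    then obtain m where m: "m \<in> F" "\<forall>i\<in>F. (i, m) \<in> r" by blast
    have "x \<noteq> m" using insert.hyps m by blast
    then have "(x, m) \<in> r \<or> (m, x) \<in> r" "(x, x) \<in> r"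
      using r by (auto simp: total_on_def refl_on_def)
    moreover have "\<forall>i\<in>F. (i, x) \<in> r" if "(m, x) \<in> r"
      using m(2) that r(2) by (meson transE)
    ultimately show ?case using m by auto
  qed
  then show thesis using that by (auto simp: underS_def)
qed

text \<open>The \<open>i\<close>-th element is chosen against the subgroup generated by \<open>S\<close> and all earlier elements. In a
  finite combination that lies in \<open>S\<close>, the term with the latest index lies in that subgroup;
  hence \<open>n\<close> divides its exponent, the term vanishes, and the next latest index takes its place.\<close>
lemma (in comm_group) exists_independent_family:
  fixes U :: "real \<Rightarrow> 'a set" and n :: nat
  assumes "subgroup S G" "S \<prec> (UNIV :: real set)" "n > 0"
    and choice: "\<And>i P. subgroup P G \<Longrightarrow> P \<prec> (UNIV :: real set) \<Longrightarrow>
      \<exists>x\<in>U i. x \<in> carrier G \<and> x [^] n = \<one> \<and> (\<forall>p. prime p \<longrightarrow> p dvd n \<longrightarrow> x [^] (n div p) \<notin> P)"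
  obtains f where "\<And>i. f i \<in> U i" "\<And>i. f i \<in> carrier G" "\<And>i. f i [^] n = \<one>"
    "independent_over G S n f"
proof -
  define Q where "Q i X x \<longleftrightarrow> x \<in> U i \<and> x \<in> carrier G \<and> x [^] n = \<one> \<and>
      (\<forall>p. prime p \<longrightarrow> p dvd n \<longrightarrow> x [^] (n div p) \<notin> generate G (S \<union> X \<inter> carrier G))" for i X x
    \<comment> \<open>The recursion principle offers arbitrary sets \<open>X\<close>; the intersection with the carrier keeps
      the generated set a subgroup.\<close>
  have S: "S \<subseteq> carrier G" using assms(1) by (rule subgroup.subset)
  have Q_ex: "\<exists>x. Q i X x" if "X \<prec> (UNIV :: real set)" for i X
  proof -
    have "X \<inter> carrier G \<prec> (UNIV :: real set)"
      using that lesspoll_trans1 subset_imp_lepoll by blast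
    then have "generate G (S \<union> X \<inter> carrier G) \<prec> (UNIV :: real set)"
      using S assms(2) uncountable_UNIV_real
      by (intro generate_lesspoll_uncountable Un_lesspoll_infinite) (auto simp: infinite_UNIV_char_0)
    moreover have "subgroup (generate G (S \<union> X \<inter> carrier G)) G"
      using S by (intro generate_is_subgroup) auto
    ultimately show ?thesis
      using choice[of _ i] unfolding Q_def by blast
  qed
  obtain r f where r: "well_order_on (UNIV :: real set) r" and f: "\<And>i. Q i (f ` underS r i) (f i)"
    using real_indexed_choice[of Q, OF Q_ex] by blast
  have fU: "f i \<in> U i" and f_car: "f i \<in> carrier G" and f_n: "f i [^] n = \<one>" for i
    using f[of i] by (auto simp: Q_def)
  define P where "P i = generate G (S \<union> f ` underS r i)" for i
  have "S \<union> f ` underS r i \<subseteq> carrier G" for i using S f_car by blast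
  then have P: "subgroup (P i) G" for i
    unfolding P_def by (rule generate_is_subgroup)
  have P_ge: "S \<union> f ` underS r i \<subseteq> P i" for i
    unfolding P_def by (auto intro: generate.incl)
  have f_P: "f i [^] (n div p) \<notin> P i" if "prime p" "p dvd n" for i p
  proof -
    have "f ` underS r i \<inter> carrier G = f ` underS r i" using f_car by blast
    then show ?thesis using f[of i] that by (simp add: Q_def P_def)
  qed
  have "\<forall>i\<in>F. int n dvd c i" if "finite F" "(\<Otimes>i\<in>F. f i [^] c i) \<in> S" for F and c :: "real \<Rightarrow> int"
    using that
  proof (induction rule: finite_psubset_induct)
    case (psubset F)
    show ?case
    proof (cases "F = {}")
      case False
      then obtain m where m: "m \<in> F" "\<And>i. i \<in> F \<Longrightarrow> i \<noteq> m \<Longrightarrow> i \<in> underS r m"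
        using well_order_finite_max[OF r] psubset.hyps by metis
      let ?F = "F - {m}" and ?y = "\<Otimes>i\<in>F - {m}. f i [^] c i"
      have split: "(\<Otimes>i\<in>F. f i [^] c i) = f m [^] c m \<otimes> ?y"
        using finprod_insert[of ?F m "\<lambda>i. f i [^] c i"] psubset.hyps m(1) f_car
        by (simp add: insert_absorb)
      have y: "?y \<in> P m"
        using m(2) P_ge[of m] by (intro finprod_in_subgroup P subgroup_int_pow_closed) auto
      have y_car: "?y \<in> carrier G" using f_car by auto
      have "f m [^] c m = (f m [^] c m \<otimes> ?y) \<otimes> inv ?y"
        using f_car y_car by (simp add: m_assoc)
      also have "\<dots> \<in> P m"
      proof (rule subgroup.m_closed[OF P])
        show "f m [^] c m \<otimes> ?y \<in> P m"
          using psubset.prems P_ge[of m] unfolding split by blast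
        show "inv ?y \<in> P m" using y by (rule subgroup.m_inv_closed[OF P])
      qed
      finally have dvd: "int n dvd c m"
        using dvd_exponent_if_pow_in_subgroup[OF f_car f_n P f_P] assms(3) by blast
      then have "f m [^] c m = \<one>" by (rule int_pow_eq_one_if_dvd[OF f_car f_n])
      then have "?y \<in> S" using psubset.prems y_car unfolding split by simp
      then have "\<forall>i\<in>?F. int n dvd c i"
        using m(1) by (intro psubset.IH) auto
      then show ?thesis using dvd by blast
    qed auto
  qed
  then have "independent_over G S n f"
    unfolding independent_over_def by blast
  then show thesis using that fU f_car f_n by blast
qed

lemma (in comm_group) independent_over_inj:
  assumes "independent_over G S n f" "inj g" "\<And>i. f i \<in> carrier G"
  shows "independent_over G S n (f \<circ> g)"
  unfolding independent_over_def
proof (intro allI impI)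
  fix F and c :: "_ \<Rightarrow> int"
  assume F: "finite F \<and> (\<Otimes>i\<in>F. (f \<circ> g) i [^] c i) \<in> S"
  have "(\<Otimes>j\<in>g ` F. f j [^] c (inv_into UNIV g j)) = (\<Otimes>i\<in>F. (f \<circ> g) i [^] c i)"
    using assms(2,3) by (subst finprod_reindex) (auto intro: inj_on_subset)
  then have "finite (g ` F) \<and> (\<Otimes>j\<in>g ` F. f j [^] c (inv_into UNIV g j)) \<in> S"
    using F by simp
  then have "\<forall>j\<in>g ` F. int n dvd c (inv_into UNIV g j)"
    using assms(1)[unfolded independent_over_def, rule_format, of "g ` F" "\<lambda>j. c (inv_into UNIV g j)"] by blast
  then show "\<forall>i\<in>F. int n dvd c i" using assms(2) by auto
qed

lemma (in comm_group) independent_generate_Int: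
  assumes "independent_over G S n f" "subgroup S G"
    and "\<And>i. f i \<in> carrier G" "\<And>i. f i [^] n = \<one>"
  shows "S \<inter> generate G (range f) = {\<one>}"
proof
  show "{\<one>} \<subseteq> S \<inter> generate G (range f)"
    using assms(2) by (auto simp: subgroup.one_closed generate.one)
  show "S \<inter> generate G (range f) \<subseteq> {\<one>}"
  proof clarify
    fix x assume x: "x \<in> S" "x \<in> generate G (range f)"
    then obtain F c where F: "finite F" "x = (\<Otimes>i\<in>F. f i [^] (c i :: int))"
      using generate_image_finprod[OF x(2)] assms(3) by blast
    then have "\<forall>i\<in>F. int n dvd c i" using assms(1) x(1) by (auto simp: independent_over_def)
    then show "x = \<one>"
      unfolding F(2) using int_pow_eq_one_if_dvd[OF assms(3,4)] by (intro finprod_one_eqI) auto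
  qed
qed

text \<open>The tails of the sequence \<open>h\<^sub>i - a\<close> generate subgroups with trivial intersection. Write \<open>x\<close> as a
  combination over a finite set \<open>F\<close> of indices and its inverse as a combination over indices beyond
  \<open>F\<close>. The two combinations cancel, so the sum of the parts that belong to the \<open>h\<^sub>i\<close> is a multiple
  of \<open>a\<close>; by independence \<open>n\<close> divides all exponents, and all terms vanish. The hypothesis that \<open>n\<close>
  annihilates \<open>a\<close> enters at this last step.\<close>
lemma (in comm_group) independent_tails_Inter:
  fixes h :: "nat \<Rightarrow> 'a"
  assumes ind: "independent_over G (generate G {a}) n h" and a: "a \<in> carrier G" "a [^] n = \<one>"
    and h: "\<And>i. h i \<in> carrier G" "\<And>i. h i [^] n = \<one>"
    and x: "\<And>k. x \<in> generate G ((\<lambda>i. h i \<otimes> inv a) ` {k..})"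
  shows "x = \<one>"
proof -
  let ?A = "generate G {a}" and ?u = "\<lambda>i. h i \<otimes> inv a"
  have A: "subgroup ?A G" and aA: "a \<in> ?A"
    using a(1) by (auto intro: generate_is_subgroup generate.incl)
  have u: "?u i \<in> carrier G" for i using a(1) h(1) by simp
  have sub: "subgroup (generate G (?u ` I)) G" for I
    using u by (intro generate_is_subgroup) auto
  have shift: "\<exists>t\<in>?A. (\<Otimes>i\<in>F. ?u i [^] c i) = (\<Otimes>i\<in>F. h i [^] c i) \<otimes> t" for F and c :: "nat \<Rightarrow> int"
  proof (rule bexI)
    have "(\<Otimes>i\<in>F. ?u i [^] c i) = (\<Otimes>i\<in>F. h i [^] c i \<otimes> inv a [^] c i)"
      using a(1) h(1) by (intro finprod_cong) (auto simp: int_pow_distrib)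
    also have "\<dots> = (\<Otimes>i\<in>F. h i [^] c i) \<otimes> (\<Otimes>i\<in>F. inv a [^] c i)"
      using a(1) h(1) by (intro finprod_multf) auto
    finally show "(\<Otimes>i\<in>F. ?u i [^] c i) = \<dots>" .
    show "(\<Otimes>i\<in>F. inv a [^] c i) \<in> ?A"
      using A aA by (intro finprod_in_subgroup subgroup_int_pow_closed subgroup.m_inv_closed) auto
  qed
  obtain F c where F: "finite F" "x = (\<Otimes>i\<in>F. ?u i [^] (c i :: int))"
    using generate_image_finprod[OF x[of 0]] u by blast
  obtain k where k: "\<forall>i\<in>F. i < k" using F(1) finite_nat_bounded by blast
  have x_car: "x \<in> carrier G" using F(2) u by simp
  have inv_x: "inv x \<in> generate G (?u ` {k..})"
    using sub x by (intro subgroup.m_inv_closed)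
  then obtain F' c' where F': "finite F'" "F' \<subseteq> {k..}" "inv x = (\<Otimes>i\<in>F'. ?u i [^] (c' i :: int))"
    using generate_image_finprod[OF inv_x] u by blast
  have disj: "F \<inter> F' = {}" using k F'(2) by fastforce
  define d where "d i = (if i \<in> F then c i else c' i)" for i
  have "(\<Otimes>i\<in>F \<union> F'. ?u i [^] d i) = (\<Otimes>i\<in>F. ?u i [^] d i) \<otimes> (\<Otimes>i\<in>F'. ?u i [^] d i)"
    using F(1) F'(1) disj u by (intro finprod_Un_disjoint) auto
  also have "(\<Otimes>i\<in>F. ?u i [^] d i) = x"
    unfolding F(2) using u by (intro finprod_cong) (auto simp: d_def)
  also have "(\<Otimes>i\<in>F'. ?u i [^] d i) = inv x"
  proof -
    have "d i = c' i" if "i \<in> F'" for i using that disj by (auto simp: d_def)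
    then show ?thesis unfolding F'(3) using u by (intro finprod_cong) auto
  qed
  finally have "(\<Otimes>i\<in>F \<union> F'. ?u i [^] d i) = \<one>" using x_car by simp
  then obtain t where t: "t \<in> ?A" "(\<Otimes>i\<in>F \<union> F'. h i [^] d i) \<otimes> t = \<one>"
    using shift[of d "F \<union> F'"] by auto
  have "(\<Otimes>i\<in>F \<union> F'. h i [^] d i) = inv t"
  proof (rule inv_equality[symmetric])
    show "(\<Otimes>i\<in>F \<union> F'. h i [^] d i) \<otimes> t = \<one>" by (rule t(2))
    show "t \<in> carrier G" using subgroup.mem_carrier[OF A t(1)] .
    show "(\<Otimes>i\<in>F \<union> F'. h i [^] d i) \<in> carrier G" using h(1) by auto
  qed
  then have "(\<Otimes>i\<in>F \<union> F'. h i [^] d i) \<in> ?A"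
    using t(1) A by (simp add: subgroup.m_inv_closed)
  then have "\<forall>i\<in>F \<union> F'. int n dvd d i"
    using ind F(1) F'(1) unfolding independent_over_def by blast
  then have "\<forall>i\<in>F. int n dvd c i" by (metis UnI1 d_def)
  moreover have u_n: "?u i [^] n = \<one>" for i
    using a h by (simp add: nat_pow_distrib nat_pow_inv)
  ultimately show "x = \<one>"
    unfolding F(2) by (intro finprod_one_eqI int_pow_eq_one_if_dvd[OF u u_n]) auto
qed

section \<open>Power maps and the algebraic form of the M-group property\<close>

text \<open>The algebraic condition that all three conditions of the theorem are compared with. It mentions no
  topology, and for an abelian group the image of the \<open>m\<close>-th power map has the size of the index of
  the \<open>m\<close>-torsion subgroup.\<close>
definition power_images_large :: "('a, 'b) monoid_scheme \<Rightarrow> bool" where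
  "power_images_large G \<longleftrightarrow>
     (\<forall>m::nat. (\<forall>g\<in>carrier G. g [^]\<^bsub>G\<^esub> m = \<one>\<^bsub>G\<^esub>) \<or>
        (UNIV :: real set) \<lesssim> (\<lambda>g. g [^]\<^bsub>G\<^esub> m) ` carrier G)"

lemma paratopological_group_continuous_mult:
  assumes "paratopological_group G T" "continuous_map X T f" "continuous_map X T g"
  shows "continuous_map X T (\<lambda>x. f x \<otimes>\<^bsub>G\<^esub> g x)"
proof -
  have "continuous_map X (prod_topology T T) (\<lambda>x. (f x, g x))"
    using assms(2,3) by (rule continuous_map_pairedI)
  moreover have "continuous_map (prod_topology T T) T (\<lambda>(x, y). x \<otimes>\<^bsub>G\<^esub> y)"
    using assms(1) by (simp add: paratopological_group_def)
  ultimately have "continuous_map X T ((\<lambda>(x, y). x \<otimes>\<^bsub>G\<^esub> y) \<circ> (\<lambda>x. (f x, g x)))"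
    by (rule continuous_map_compose)
  then show ?thesis by (simp add: o_def)
qed

lemma paratopological_group_continuous_pow:
  assumes "paratopological_group G T" "continuous_map X T f"
  shows "continuous_map X T (\<lambda>x. f x [^]\<^bsub>G\<^esub> (n :: nat))"
proof (induction n)
  case 0
  have "\<one>\<^bsub>G\<^esub> \<in> topspace T"
    using assms(1) by (auto simp: paratopological_group_def intro: monoid.one_closed group.is_monoid)
  then show ?case by simp
next
  case (Suc n)
  then show ?case
    using paratopological_group_continuous_mult[OF assms(1) Suc assms(2)] by simp
qed

lemma closedin_torsion:
  assumes "paratopological_group G T" "Hausdorff_space T"
  shows "closedin T {g \<in> carrier G. g [^]\<^bsub>G\<^esub> (m :: nat) = \<one>\<^bsub>G\<^esub>}"
proof -
  have top: "topspace T = carrier G" and one: "\<one>\<^bsub>G\<^esub> \<in> carrier G"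
    using assms(1) by (auto simp: paratopological_group_def intro: monoid.one_closed group.is_monoid)
  have "continuous_map T T (\<lambda>g. g [^]\<^bsub>G\<^esub> m)"
    using assms(1) by (intro paratopological_group_continuous_pow) auto
  moreover have "continuous_map T T (\<lambda>g. \<one>\<^bsub>G\<^esub>)"
    using one top by simp
  ultimately have "closedin T {g \<in> topspace T. g [^]\<^bsub>G\<^esub> m = \<one>\<^bsub>G\<^esub>}"
    using assms(2) by (rule closedin_continuous_maps_eq[rotated])
  then show ?thesis by (simp add: top)
qed

lemma (in comm_group) subgroup_torsion: "subgroup {g \<in> carrier G. g [^] (m :: nat) = \<one>} G"
  by unfold_locales (auto simp: nat_pow_distrib nat_pow_inv)

lemma (in comm_group) subgroup_power_image: "subgroup ((\<lambda>g. g [^] (m :: nat)) ` carrier G) G"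
proof
  show "(\<lambda>g. g [^] m) ` carrier G \<subseteq> carrier G" by auto
  show "x \<otimes> y \<in> (\<lambda>g. g [^] m) ` carrier G"
    if "x \<in> (\<lambda>g. g [^] m) ` carrier G" "y \<in> (\<lambda>g. g [^] m) ` carrier G" for x y
    using that by (auto simp: nat_pow_distrib[symmetric])
  show "\<one> \<in> (\<lambda>g. g [^] m) ` carrier G" by (rule image_eqI[of _ _ \<one>]) auto
  show "inv x \<in> (\<lambda>g. g [^] m) ` carrier G" if "x \<in> (\<lambda>g. g [^] m) ` carrier G" for x
    using that by (auto simp: nat_pow_inv[symmetric])
qed

text \<open>A dense subgroup \<open>D\<close> that meets \<open>mG\<close> trivially satisfies \<open>mD = 0\<close>, because \<open>mD\<close> lies in both \<open>D\<close>
  and \<open>mG\<close>. Then the \<open>m\<close>-torsion subgroup is dense and closed.\<close>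
lemma d_independent_imp_power_images_large:
  assumes "comm_group G" "Hausdorff_space T" "d_independent G T"
  shows "power_images_large G"
  unfolding power_images_large_def
proof (intro allI disjCI)
  interpret comm_group G by fact
  fix m :: nat
  let ?M = "(\<lambda>g. g [^]\<^bsub>G\<^esub> m) ` carrier G" and ?Z = "{g \<in> carrier G. g [^]\<^bsub>G\<^esub> m = \<one>\<^bsub>G\<^esub>}"
  assume "\<not> (UNIV :: real set) \<lesssim> ?M"
  then have "?M \<prec> (UNIV :: real set)" by (simp add: lesspoll_iff_not_lepoll)
  then obtain D where D: "dense_subgroup G T D" "?M \<inter> D = {\<one>\<^bsub>G\<^esub>}"
    using assms(3) subgroup_power_image unfolding d_independent_def by blast
  have para: "paratopological_group G T" and top: "topspace T = carrier G"
    using assms(3) by (auto simp: d_independent_def paratopological_group_def)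
  have sub: "subgroup D G" and dense: "T closure_of D = carrier G"
    using D(1) top by (auto simp: dense_subgroup_def)
  have "D \<subseteq> ?Z"
  proof
    fix d assume d: "d \<in> D"
    then have "d \<in> carrier G" using subgroup.mem_carrier[OF sub] by blast
    moreover have "d [^]\<^bsub>G\<^esub> m \<in> D"
      using subgroup_int_pow_closed[OF sub d, of "int m"] by (simp add: int_pow_int)
    ultimately show "d \<in> ?Z" using D(2) by blast
  qed
  then have "carrier G \<subseteq> ?Z"
    using closure_of_minimal[OF _ closedin_torsion[OF para assms(2)]] dense by blast
  then show "\<forall>g\<in>carrier G. g [^]\<^bsub>G\<^esub> m = \<one>\<^bsub>G\<^esub>" by blast
qed

text \<open>The cosets of the \<open>m\<close>-torsion subgroup are the nonempty fibres of the \<open>m\<close>-th power map.\<close>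
lemma M_group_imp_power_images_large:
  assumes "comm_group G" "M_group G"
  shows "power_images_large G"
  unfolding power_images_large_def
proof (intro allI disj_imp[THEN iffD2] impI)
  interpret comm_group G by fact
  fix m :: nat
  let ?Z = "{g \<in> carrier G. g [^]\<^bsub>G\<^esub> m = \<one>\<^bsub>G\<^esub>}"
  assume "\<not> (\<forall>g\<in>carrier G. g [^]\<^bsub>G\<^esub> m = \<one>\<^bsub>G\<^esub>)"
  then have "?Z \<noteq> carrier G" by blast
  moreover have "unconditionally_closed G ?Z"
    unfolding unconditionally_closed_def topological_group_def using closedin_torsion by blast
  ultimately have "(UNIV :: real set) \<lesssim> rcosets\<^bsub>G\<^esub> ?Z"
    using assms(2) subgroup_torsion unfolding M_group_def by blast
  also have "rcosets\<^bsub>G\<^esub> ?Z \<subseteq> (\<lambda>y. {g \<in> carrier G. g [^]\<^bsub>G\<^esub> m = y}) ` (\<lambda>g. g [^]\<^bsub>G\<^esub> m) ` carrier G"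
  proof
    fix K assume "K \<in> rcosets\<^bsub>G\<^esub> ?Z"
    then obtain x where x: "x \<in> carrier G" "K = ?Z #>\<^bsub>G\<^esub> x" by (auto simp: RCOSETS_def)
    have "K = {g \<in> carrier G. g [^]\<^bsub>G\<^esub> m = x [^]\<^bsub>G\<^esub> m}"
    proof (intro equalityI subsetI)
      fix g assume "g \<in> K"
      then show "g \<in> {g \<in> carrier G. g [^]\<^bsub>G\<^esub> m = x [^]\<^bsub>G\<^esub> m}"
        using x by (auto simp: r_coset_def nat_pow_distrib)
    next
      fix g assume g: "g \<in> {g \<in> carrier G. g [^]\<^bsub>G\<^esub> m = x [^]\<^bsub>G\<^esub> m}"
      then have "g \<otimes>\<^bsub>G\<^esub> inv\<^bsub>G\<^esub> x \<in> ?Z" using x by (simp add: nat_pow_distrib nat_pow_inv)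
      moreover have "g = g \<otimes>\<^bsub>G\<^esub> inv\<^bsub>G\<^esub> x \<otimes>\<^bsub>G\<^esub> x" using g x by (simp add: m_assoc)
      ultimately show "g \<in> K" unfolding x(2) r_coset_def by blast
    qed
    then show "K \<in> (\<lambda>y. {g \<in> carrier G. g [^]\<^bsub>G\<^esub> m = y}) ` (\<lambda>g. g [^]\<^bsub>G\<^esub> m) ` carrier G"
      using x(1) by blast
  qed
  then have "rcosets\<^bsub>G\<^esub> ?Z \<lesssim> (\<lambda>g. g [^]\<^bsub>G\<^esub> m) ` carrier G"
    by (rule subset_image_lepoll)
  finally show "(UNIV :: real set) \<lesssim> (\<lambda>g. g [^]\<^bsub>G\<^esub> m) ` carrier G" .
qed

section \<open>Proper unconditionally closed subgroups have large index\<close>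

text \<open>The linear group topology in which a decreasing sequence of subgroups is a base at the neutral
  element. Trivial intersection is what makes it Hausdorff: cosets of the same subgroup are disjoint or
  equal.\<close>
lemma (in comm_group) exists_topology_from_subgroup_chain:
  fixes U :: "nat \<Rightarrow> 'a set"
  assumes sub: "\<And>k. subgroup (U k) G" and mono: "\<And>k l. k \<le> l \<Longrightarrow> U l \<subseteq> U k"
    and Int: "\<And>x. (\<And>k. x \<in> U k) \<Longrightarrow> x = \<one>"
  obtains T where "topological_group G T" "Hausdorff_space T"
    "\<And>W. openin T W \<longleftrightarrow> W \<subseteq> carrier G \<and> (\<forall>x\<in>W. \<exists>k. \<forall>u\<in>U k. x \<otimes> u \<in> W)"
proof -
  define P where "P W \<longleftrightarrow> W \<subseteq> carrier G \<and> (\<forall>x\<in>W. \<exists>k. \<forall>u\<in>U k. x \<otimes> u \<in> W)" for W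
  have U_car: "u \<in> carrier G" if "u \<in> U k" for u k
    using subgroup.mem_carrier[OF sub that] .
  have "istopology P"
    unfolding istopology_def
  proof (intro conjI allI impI)
    fix A B assume A: "P A" and B: "P B"
    show "P (A \<inter> B)"
      unfolding P_def
    proof (intro conjI ballI)
      show "A \<inter> B \<subseteq> carrier G" using A by (auto simp: P_def)
      fix x assume "x \<in> A \<inter> B"
      then obtain k l where "\<forall>u\<in>U k. x \<otimes> u \<in> A" "\<forall>u\<in>U l. x \<otimes> u \<in> B"
        using A B unfolding P_def by blast
      then have "\<forall>u\<in>U (max k l). x \<otimes> u \<in> A \<inter> B"
        using mono[of k "max k l"] mono[of l "max k l"] by auto
      then show "\<exists>k. \<forall>u\<in>U k. x \<otimes> u \<in> A \<inter> B" by blast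
    qed
  next
    fix K assume "\<forall>A\<in>K. P A"
    then show "P (\<Union>K)" unfolding P_def by (meson Sup_le_iff UnionE UnionI)
  qed
  then have op: "openin (topology P) W \<longleftrightarrow> P W" for W
    by (simp add: topology_inverse')
  define T where "T = topology P"
  have op: "openin T W \<longleftrightarrow> P W" for W by (simp add: T_def op)
  have "P (carrier G)" using U_car by (auto simp: P_def)
  then have top: "topspace T = carrier G"
    unfolding topspace_def op by (auto simp: P_def)
  have coset: "openin T ((\<lambda>u. x \<otimes> u) ` U k)" if "x \<in> carrier G" for x k
    unfolding op P_def
  proof (intro conjI ballI)
    show "(\<lambda>u. x \<otimes> u) ` U k \<subseteq> carrier G" using that U_car by auto
    fix y assume "y \<in> (\<lambda>u. x \<otimes> u) ` U k"
    then obtain v where v: "v \<in> U k" "y = x \<otimes> v" by blast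
    have "y \<otimes> u \<in> (\<lambda>u. x \<otimes> u) ` U k" if "u \<in> U k" for u
      using v that \<open>x \<in> carrier G\<close> U_car subgroup.m_closed[OF sub]
      by (auto simp: m_assoc)
    then show "\<exists>l. \<forall>u\<in>U l. y \<otimes> u \<in> (\<lambda>u. x \<otimes> u) ` U k" by blast
  qed
  have mem_coset: "x \<in> (\<lambda>u. x \<otimes> u) ` U k" if "x \<in> carrier G" for x k
    using that subgroup.one_closed[OF sub] by (intro image_eqI[of _ _ \<one>]) auto
  have "continuous_map (prod_topology T T) T (\<lambda>(x, y). x \<otimes> y)"
    unfolding continuous_map_def
  proof (intro conjI allI impI)
    show "(\<lambda>(x, y). x \<otimes> y) \<in> topspace (prod_topology T T) \<rightarrow> topspace T"
      by (auto simp: top)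
    fix W assume W: "openin T W"
    show "openin (prod_topology T T) {z \<in> topspace (prod_topology T T). (case z of (x, y) \<Rightarrow> x \<otimes> y) \<in> W}"
      unfolding openin_prod_topology_alt
    proof (intro allI impI)
      fix x y assume "(x, y) \<in> {z \<in> topspace (prod_topology T T). (case z of (x, y) \<Rightarrow> x \<otimes> y) \<in> W}"
      then have xy: "x \<in> carrier G" "y \<in> carrier G" "x \<otimes> y \<in> W" by (auto simp: top)
      then obtain k where k: "\<forall>u\<in>U k. x \<otimes> y \<otimes> u \<in> W" using W unfolding op P_def by blast
      let ?A = "(\<lambda>u. x \<otimes> u) ` U k" and ?B = "(\<lambda>u. y \<otimes> u) ` U k"
      have "(x \<otimes> u) \<otimes> (y \<otimes> v) \<in> W" if "u \<in> U k" "v \<in> U k" for u v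
      proof -
        have "(x \<otimes> u) \<otimes> (y \<otimes> v) = x \<otimes> y \<otimes> (u \<otimes> v)"
          using xy U_car[OF that(1)] U_car[OF that(2)] by (simp add: m_assoc m_lcomm)
        then show ?thesis using k subgroup.m_closed[OF sub that] by simp
      qed
      then have in_W: "a \<otimes> b \<in> W" if "a \<in> ?A" "b \<in> ?B" for a b using that by blast
      have A_B_car: "?A \<subseteq> carrier G" "?B \<subseteq> carrier G" using xy(1,2) U_car by auto
      have "?A \<times> ?B \<subseteq> {z \<in> topspace (prod_topology T T). (case z of (x, y) \<Rightarrow> x \<otimes> y) \<in> W}"
      proof
        fix z assume "z \<in> ?A \<times> ?B"
        then obtain a b where ab: "z = (a, b)" "a \<in> ?A" "b \<in> ?B" by (rule SigmaE)
        then have "a \<in> carrier G" "b \<in> carrier G" using A_B_car by blast+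
        then show "z \<in> {z \<in> topspace (prod_topology T T). (case z of (x, y) \<Rightarrow> x \<otimes> y) \<in> W}"
          using in_W[OF ab(2,3)] by (simp add: top ab(1))
      qed
      then show "\<exists>A B. openin T A \<and> openin T B \<and> x \<in> A \<and> y \<in> B \<and>
          A \<times> B \<subseteq> {z \<in> topspace (prod_topology T T). (case z of (x, y) \<Rightarrow> x \<otimes> y) \<in> W}"
        using coset[OF xy(1)] coset[OF xy(2)] mem_coset[OF xy(1)] mem_coset[OF xy(2)]
        by (intro exI[of _ ?A] exI[of _ ?B] conjI)
    qed
  qed
  then have para: "paratopological_group G T"
    by (simp add: paratopological_group_def top group_axioms)
  have "continuous_map T T (\<lambda>x. inv x)"
    unfolding continuous_map_def
  proof (intro conjI allI impI)
    show "(\<lambda>x. inv x) \<in> topspace T \<rightarrow> topspace T" by (auto simp: top)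
    fix W assume W: "openin T W"
    show "openin T {x \<in> topspace T. inv x \<in> W}"
      unfolding op P_def
    proof (intro conjI ballI)
      show "{x \<in> topspace T. inv x \<in> W} \<subseteq> carrier G" by (auto simp: top)
      fix x assume "x \<in> {x \<in> topspace T. inv x \<in> W}"
      then have x: "x \<in> carrier G" "inv x \<in> W" by (auto simp: top)
      then obtain k where k: "\<forall>u\<in>U k. inv x \<otimes> u \<in> W" using W unfolding op P_def by blast
      have "x \<otimes> u \<in> {x \<in> topspace T. inv x \<in> W}" if "u \<in> U k" for u
        using k subgroup.m_inv_closed[OF sub that] x(1) U_car[OF that]
        by (simp add: top inv_mult)
      then show "\<exists>k. \<forall>u\<in>U k. x \<otimes> u \<in> {x \<in> topspace T. inv x \<in> W}" by blast
    qed
  qed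
  then have "topological_group G T" using para by (simp add: topological_group_def)
  moreover have "Hausdorff_space T"
    unfolding Hausdorff_space_def
  proof (intro allI impI)
    fix x y assume "x \<in> topspace T \<and> y \<in> topspace T \<and> x \<noteq> y"
    then have xy: "x \<in> carrier G" "y \<in> carrier G" "x \<noteq> y" by (auto simp: top)
    then have "inv x \<otimes> y \<noteq> \<one>" by (metis inv_closed inv_equality inv_inv)
    then obtain k where k: "inv x \<otimes> y \<notin> U k" using Int by blast
    have disj: "disjnt ((\<lambda>u. x \<otimes> u) ` U k) ((\<lambda>u. y \<otimes> u) ` U k)"
      unfolding disjnt_iff
    proof (intro allI notI, elim conjE imageE)
      fix z u v assume uv: "u \<in> U k" "v \<in> U k" "z = x \<otimes> u" "z = y \<otimes> v"
      note car = U_car[OF uv(1)] U_car[OF uv(2)] xy(1,2)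
      have "inv x \<otimes> y = inv x \<otimes> (y \<otimes> v) \<otimes> inv v"
        using car by (simp add: m_assoc)
      also have "\<dots> = inv x \<otimes> (x \<otimes> u) \<otimes> inv v" using uv by simp
      also have "\<dots> = u \<otimes> inv v" using car by (simp add: m_assoc[symmetric])
      also have "\<dots> \<in> U k"
        using subgroup.m_closed[OF sub uv(1) subgroup.m_inv_closed[OF sub uv(2)]] .
      finally show False using k by blast
    qed
    show "\<exists>A B. openin T A \<and> openin T B \<and> x \<in> A \<and> y \<in> B \<and> disjnt A B"
      using coset[OF xy(1)] coset[OF xy(2)] mem_coset[OF xy(1)] mem_coset[OF xy(2)] disj
      by (intro exI conjI)
  qed
  ultimately show thesis using that op unfolding P_def by blast
qed

text \<open>A homomorphism with large image has large image on every set \<open>W\<close> whose translates by few elements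
  cover the group. It is used with a subgroup \<open>W\<close> of small index and a transversal \<open>C\<close>, and with a
  neighbourhood \<open>W\<close> of the neutral element and a countable dense set \<open>C\<close>.\<close>
lemma (in comm_group) power_image_of_factor:
  assumes "C \<subseteq> carrier G" "W \<subseteq> carrier G" "C \<prec> (UNIV :: real set)"
    and "\<And>g. g \<in> carrier G \<Longrightarrow> \<exists>c\<in>C. \<exists>w\<in>W. g = c \<otimes> w"
    and "(UNIV :: real set) \<lesssim> (\<lambda>g. g [^] (n :: nat)) ` carrier G"
    and "Y \<prec> (UNIV :: real set)"
  shows "\<exists>w\<in>W. w [^] n \<notin> Y"
proof (rule ccontr)
  assume "\<not> (\<exists>w\<in>W. w [^] n \<notin> Y)"
  then have W: "\<forall>w\<in>W. w [^] n \<in> Y" by blast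
  have "(\<lambda>g. g [^] n) ` carrier G \<subseteq> (\<lambda>(c, y). c [^] n \<otimes> y) ` (C \<times> Y)"
  proof clarify
    fix g assume "g \<in> carrier G"
    then obtain c w where cw: "c \<in> C" "w \<in> W" "g = c \<otimes> w" using assms(4) by blast
    then have "g [^] n = c [^] n \<otimes> w [^] n"
      using assms(1,2) by (simp add: nat_pow_distrib subset_iff)
    then show "g [^] n \<in> (\<lambda>(c, y). c [^] n \<otimes> y) ` (C \<times> Y)"
      using cw W by (intro image_eqI[of _ _ "(c, w [^] n)"]) auto
  qed
  then have "(UNIV :: real set) \<lesssim> C \<times> Y"
    using assms(5) subset_image_lepoll lepoll_trans by blast
  moreover have "C \<times> Y \<prec> (UNIV :: real set)"
    using assms(3,6) by (intro Times_lesspoll_infinite) (auto simp: infinite_UNIV_char_0)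
  ultimately show False by (simp add: lesspoll_iff_not_lepoll)
qed

lemma (in group) bounded_group_exponent:
  assumes "bounded_group G"
  obtains N :: nat where "N > 0" "\<And>g. g \<in> carrier G \<Longrightarrow> g [^] N = \<one>"
    "\<And>m. (\<And>g. g \<in> carrier G \<Longrightarrow> g [^] m = \<one>) \<Longrightarrow> N dvd m"
proof -
  let ?E = "\<lambda>m::nat. m > 0 \<and> (\<forall>g\<in>carrier G. g [^] m = \<one>)"
  define N where "N = (LEAST m. ?E m)"
  have N: "?E N"
    unfolding N_def using assms LeastI_ex[of ?E] by (simp add: bounded_group_def)
  have "N dvd m" if m: "\<And>g. g \<in> carrier G \<Longrightarrow> g [^] m = \<one>" for m
  proof -
    have "?E (gcd m N)"
      using N m by (auto simp: pow_eq_id)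
    then have "N \<le> gcd m N" unfolding N_def by (rule Least_le)
    then have "gcd m N = N" using N by (meson dvd_imp_le gcd_dvd2 le_antisym)
    then show ?thesis by (metis gcd_dvd1)
  qed
  then show thesis using that N by blast
qed

text \<open>By minimality of the exponent \<open>N\<close>, the image is nontrivial as soon as \<open>N\<close> does not divide
  \<open>(N/p)m\<close>. The factor \<open>m\<close> makes it possible to pass to the \<open>p\<close>-primary part of the group.\<close>
lemma (in group) prime_quotient_power_image_large:
  assumes "power_images_large G" "N > (0::nat)" "prime p" "p dvd N" "\<not> p dvd m"
    and exp: "\<And>m. (\<And>g. g \<in> carrier G \<Longrightarrow> g [^] m = \<one>) \<Longrightarrow> N dvd m"
  shows "(UNIV :: real set) \<lesssim> (\<lambda>g. g [^] (N div p * m)) ` carrier G"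
proof -
  obtain l where l: "N = p * l" using assms(4) by blast
  have "p > 0" "l > 0" using assms(2) l by auto
  have "\<not> N dvd N div p * m"
  proof
    assume "N dvd N div p * m"
    then have "l * p dvd l * m" using l \<open>p > 0\<close> by (simp add: mult.commute)
    then show False using \<open>l > 0\<close> assms(5) by simp
  qed
  then show ?thesis using assms(1) exp unfolding power_images_large_def by blast
qed

text \<open>Every proper subgroup \<open>H\<close> of small index fails to be closed in some Hausdorff group topology:
  elements of \<open>H\<close> can be made to converge to a point \<open>a\<close> outside \<open>H\<close>.\<close>
lemma power_images_large_imp_M_group:
  assumes "comm_group G" "bounded_group G" "power_images_large G"
  shows "M_group G"
  unfolding M_group_def
proof (intro conjI allI impI)
  interpret comm_group G by fact
  show "group G" by (rule group_axioms)
  fix H assume "subgroup H G \<and> H \<noteq> carrier G \<and> unconditionally_closed G H"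
  then have H: "subgroup H G" and "H \<noteq> carrier G" and closed: "unconditionally_closed G H"
    by blast+
  then obtain b where b: "b \<in> carrier G" "b \<notin> H"
    using subgroup.subset by blast
  have H_car: "x \<in> carrier G" if "x \<in> H" for x using subgroup.mem_carrier[OF H that] .
  have H_pow: "x [^]\<^bsub>G\<^esub> (i :: nat) \<in> H" if "x \<in> H" for x i
    using subgroup_int_pow_closed[OF H that, of "int i"] by (simp add: int_pow_int)
  obtain N :: nat where N: "N > 0" "\<And>g. g \<in> carrier G \<Longrightarrow> g [^]\<^bsub>G\<^esub> N = \<one>\<^bsub>G\<^esub>"
    and exp: "\<And>m. (\<And>g. g \<in> carrier G \<Longrightarrow> g [^]\<^bsub>G\<^esub> m = \<one>\<^bsub>G\<^esub>) \<Longrightarrow> N dvd m"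
    using bounded_group_exponent[OF assms(2)] by blast
  show "(UNIV :: real set) \<lesssim> rcosets\<^bsub>G\<^esub> H"
  proof (rule ccontr)
    assume "\<not> (UNIV :: real set) \<lesssim> rcosets\<^bsub>G\<^esub> H"
    then have small: "rcosets\<^bsub>G\<^esub> H \<prec> (UNIV :: real set)" by (simp add: lesspoll_iff_not_lepoll)
    let ?R = "\<lambda>n::nat. n > 0 \<and> (\<exists>a\<in>carrier G - H. a [^]\<^bsub>G\<^esub> n = \<one>\<^bsub>G\<^esub>)"
    define n where "n = (LEAST n. ?R n)"
    have "?R N" using N b by blast
    then have "?R n" unfolding n_def by (rule LeastI)
    then obtain a where a: "a \<in> carrier G" "a \<notin> H" "a [^]\<^bsub>G\<^esub> n = \<one>\<^bsub>G\<^esub>" and "n > 0" by blast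
    have least: "c \<in> H" if "c \<in> carrier G" "c [^]\<^bsub>G\<^esub> k = \<one>\<^bsub>G\<^esub>" "0 < k" "k < n" for c k
      using not_less_Least[of k ?R] that unfolding n_def by blast
    have "n = ord a"
    proof (rule ccontr)
      assume "n \<noteq> ord a"
      moreover have "ord a dvd n" using a by (simp add: pow_eq_id)
      ultimately have "0 < ord a" "ord a < n"
        using \<open>n > 0\<close> by (auto simp: dvd_pos_nat dest: dvd_imp_le intro: le_neq_implies_less)
      then show False using least[of a "ord a"] a by simp
    qed
    then have "n dvd N" using N(2)[OF a(1)] a(1) by (simp add: pow_eq_id)
    then obtain r where r: "N = n * r" by blast
    have "n \<noteq> 1" using a(1,2,3) subgroup.one_closed[OF H] by auto
    then obtain p where p: "prime p" "p dvd n" using prime_factor_nat by blast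
    \<comment> \<open>By minimality \<open>n\<close> is a prime power: \<open>H\<close> contains \<open>qa\<close> for each prime divisor \<open>q\<close> of \<open>n\<close>, and for
      two different primes these multiples would generate \<open>a\<close>.\<close>
    have prime_pow: "a [^]\<^bsub>G\<^esub> q \<in> H" if q: "prime q" "q dvd n" for q
    proof (rule least)
      show "a [^]\<^bsub>G\<^esub> q \<in> carrier G" using a(1) by simp
      have "(a [^]\<^bsub>G\<^esub> q) [^]\<^bsub>G\<^esub> (n div q) = a [^]\<^bsub>G\<^esub> (q * (n div q))"
        using a(1) by (rule nat_pow_pow)
      then show "(a [^]\<^bsub>G\<^esub> q) [^]\<^bsub>G\<^esub> (n div q) = \<one>\<^bsub>G\<^esub>" using q(2) a(3) by simp
      show "0 < n div q"
        using q \<open>n > 0\<close> by (meson div_greater_zero_iff dvd_imp_le prime_gt_0_nat)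
      show "n div q < n" using q(1) \<open>n > 0\<close> prime_gt_1_nat by (intro div_less_dividend)
    qed
    have unique: "q = p" if q: "prime q" "q dvd n" for q
    proof (rule ccontr)
      assume "q \<noteq> p"
      then have "gcd (int p) (int q) = 1"
        using p(1) q(1) primes_coprime by (metis coprime_iff_gcd_eq_1 coprime_int_iff)
      then obtain u v where uv: "u * int p + v * int q = 1"
        using bezout_int[of "int p" "int q"] by metis
      have "a = a [^]\<^bsub>G\<^esub> (int p * u + int q * v)"
        using uv a(1) by (simp add: mult.commute)
      also have "\<dots> = (a [^]\<^bsub>G\<^esub> p) [^]\<^bsub>G\<^esub> u \<otimes>\<^bsub>G\<^esub> (a [^]\<^bsub>G\<^esub> q) [^]\<^bsub>G\<^esub> v"
        using a(1) by (simp add: int_pow_mult int_pow_pow flip: int_pow_int)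
      also have "\<dots> \<in> H"
        by (intro subgroup.m_closed[OF H] subgroup_int_pow_closed[OF H] prime_pow p q)
      finally show False using a(2) by blast
    qed
    define C where "C = (\<lambda>K. SOME g. g \<in> K) ` (rcosets\<^bsub>G\<^esub> H)"
    have C: "C \<prec> (UNIV :: real set)" unfolding C_def using small by (rule image_lesspoll)
    have rep: "(SOME g. g \<in> K) \<in> K" if K: "K \<in> rcosets\<^bsub>G\<^esub> H" for K
    proof -
      obtain x where "x \<in> carrier G" "K = H #>\<^bsub>G\<^esub> x" using K by (auto simp: RCOSETS_def)
      then have "x \<in> K" using rcos_self[OF _ H] by blast
      then show ?thesis by (rule someI)
    qed
    have C_car: "C \<subseteq> carrier G"
    proof
      fix c assume "c \<in> C"
      then obtain K where K: "K \<in> rcosets\<^bsub>G\<^esub> H" "c = (SOME g. g \<in> K)" by (auto simp: C_def)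
      obtain x where "x \<in> carrier G" "K = H #>\<^bsub>G\<^esub> x" using K(1) by (auto simp: RCOSETS_def)
      then have "K \<subseteq> carrier G" using r_coset_subset_G[OF subgroup.subset[OF H]] by blast
      then show "c \<in> carrier G" using rep[OF K(1)] K(2) by blast
    qed
    have factor: "\<exists>c\<in>C. \<exists>h\<in>H. g = c \<otimes>\<^bsub>G\<^esub> h" if g: "g \<in> carrier G" for g
    proof -
      let ?K = "H #>\<^bsub>G\<^esub> g" and ?c = "SOME x. x \<in> H #>\<^bsub>G\<^esub> g"
      have K: "?K \<in> rcosets\<^bsub>G\<^esub> H" using g by (auto simp: RCOSETS_def)
      then obtain h where h: "h \<in> H" "?c = h \<otimes>\<^bsub>G\<^esub> g"
        using rep[OF K] by (auto simp: r_coset_def)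
      have "g = ?c \<otimes>\<^bsub>G\<^esub> inv\<^bsub>G\<^esub> h"
        unfolding h(2) using g H_car[OF h(1)] by (simp add: m_ac)
      then show ?thesis
        using K subgroup.m_inv_closed[OF H h(1)] unfolding C_def by blast
    qed
    have "p dvd N" using p(2) r by simp
    then have large: "(UNIV :: real set) \<lesssim> (\<lambda>g. g [^]\<^bsub>G\<^esub> (N div p)) ` carrier G"
      using prime_quotient_power_image_large[OF assms(3) N(1) p(1) _ _ exp, of 1]
        prime_gt_1_nat[OF p(1)] by simp
    \<comment> \<open>From \<open>h\<close> in \<open>H\<close> with \<open>(N/p)h\<close> outside \<open>P\<close>, the multiple \<open>rh\<close> is annihilated by \<open>n\<close> and
      satisfies \<open>(n/p)(rh) = (N/p)h\<close>.\<close>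
    have choice: "\<exists>x\<in>H. x \<in> carrier G \<and> x [^]\<^bsub>G\<^esub> n = \<one>\<^bsub>G\<^esub> \<and>
        (\<forall>q. prime q \<longrightarrow> q dvd n \<longrightarrow> x [^]\<^bsub>G\<^esub> (n div q) \<notin> P)"
      if P: "P \<prec> (UNIV :: real set)" for P
    proof -
      obtain h where h: "h \<in> H" "h [^]\<^bsub>G\<^esub> (N div p) \<notin> P"
        using power_image_of_factor[OF C_car subgroup.subset[OF H] C factor large P] by blast
      show ?thesis
      proof (intro bexI[of _ "h [^]\<^bsub>G\<^esub> r"] conjI allI impI)
        show "h [^]\<^bsub>G\<^esub> r \<in> H" using H_pow h(1) .
        then show "h [^]\<^bsub>G\<^esub> r \<in> carrier G" by (rule H_car)
        show "(h [^]\<^bsub>G\<^esub> r) [^]\<^bsub>G\<^esub> n = \<one>\<^bsub>G\<^esub>"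
          using H_car[OF h(1)] N(2) r by (simp add: nat_pow_pow mult.commute)
        fix q assume "prime q" "q dvd n"
        then have "q = p" by (rule unique)
        moreover have "r * (n div p) = N div p" using r p(2) by (simp add: div_mult_swap mult.commute)
        ultimately show "(h [^]\<^bsub>G\<^esub> r) [^]\<^bsub>G\<^esub> (n div q) \<notin> P"
          using h(2) H_car[OF h(1)] by (simp add: nat_pow_pow)
      qed
    qed
    have "subgroup (generate G {a}) G" using a(1) by (intro generate_is_subgroup) auto
    moreover have "generate G {a} \<prec> (UNIV :: real set)"
      using a(1) by (intro countable_imp_lesspoll_reals countable_generate) auto
    ultimately obtain f :: "real \<Rightarrow> 'a" where f: "\<And>i. f i \<in> H" "\<And>i. f i \<in> carrier G"
        "\<And>i. f i [^]\<^bsub>G\<^esub> n = \<one>\<^bsub>G\<^esub>" "independent_over G (generate G {a}) n f"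
      using exists_independent_family[of "generate G {a}" n "\<lambda>_. H"] \<open>n > 0\<close> choice by metis
    \<comment> \<open>A countable part of the family is enough for the topology.\<close>
    define h where "h = f \<circ> real"
    have h: "\<And>i. h i \<in> H" "\<And>i. h i \<in> carrier G" "\<And>i. h i [^]\<^bsub>G\<^esub> n = \<one>\<^bsub>G\<^esub>"
      using f by (auto simp: h_def)
    have ind: "independent_over G (generate G {a}) n h"
      unfolding h_def using f(4,2) by (intro independent_over_inj inj_of_nat) auto
    define U where "U k = generate G ((\<lambda>i. h i \<otimes>\<^bsub>G\<^esub> inv\<^bsub>G\<^esub> a) ` {k..})" for k :: nat
    have "subgroup (U k) G" for k
      unfolding U_def using h(2) a(1) by (intro generate_is_subgroup) auto
    moreover have "U l \<subseteq> U k" if "k \<le> l" for k l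
      unfolding U_def using that h(2) a(1) by (intro mono_generate image_mono) auto
    moreover have "x = \<one>\<^bsub>G\<^esub>" if "\<And>k. x \<in> U k" for x
      using independent_tails_Inter[OF ind a(1,3) h(2,3)] that unfolding U_def by blast
    ultimately obtain T where T: "topological_group G T" "Hausdorff_space T"
      "\<And>W. openin T W \<longleftrightarrow> W \<subseteq> carrier G \<and> (\<forall>x\<in>W. \<exists>k. \<forall>u\<in>U k. x \<otimes>\<^bsub>G\<^esub> u \<in> W)"
      using exists_topology_from_subgroup_chain[of U] by metis
    have top: "topspace T = carrier G"
      using T(1) by (auto simp: topological_group_def paratopological_group_def)
    have "closedin T H" using closed T(1,2) by (auto simp: unconditionally_closed_def)
    then have "openin T (carrier G - H)" using top by (metis openin_diff openin_topspace)
    \<comment> \<open>The complement of \<open>H\<close> would contain some \<open>a + U\<^sub>k\<close>, but \<open>h\<^sub>k\<close> lies in that coset.\<close>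
    then obtain k where k: "\<forall>u\<in>U k. a \<otimes>\<^bsub>G\<^esub> u \<in> carrier G - H"
      using T(3) a(1,2) by blast
    have "h k \<otimes>\<^bsub>G\<^esub> inv\<^bsub>G\<^esub> a \<in> U k" unfolding U_def by (intro generate.incl) auto
    moreover have "a \<otimes>\<^bsub>G\<^esub> (h k \<otimes>\<^bsub>G\<^esub> inv\<^bsub>G\<^esub> a) = h k \<otimes>\<^bsub>G\<^esub> (a \<otimes>\<^bsub>G\<^esub> inv\<^bsub>G\<^esub> a)"
      using a(1) h(2)[of k] by (intro m_lcomm) auto
    ultimately show False using k h(1)[of k] h(2)[of k] a(1) by (metis DiffD2 r_inv r_one)
  qed
qed

section \<open>Dense subgroups that avoid a small subgroup\<close>

lemma dense_iff_meets_open: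
  assumes "D \<subseteq> topspace T"
  shows "T closure_of D = topspace T \<longleftrightarrow> (\<forall>W. openin T W \<longrightarrow> W \<noteq> {} \<longrightarrow> D \<inter> W \<noteq> {})"
proof
  assume dense: "T closure_of D = topspace T"
  show "\<forall>W. openin T W \<longrightarrow> W \<noteq> {} \<longrightarrow> D \<inter> W \<noteq> {}"
  proof (intro allI impI)
    fix W assume W: "openin T W" "W \<noteq> {}"
    then obtain x where "x \<in> W" by blast
    moreover have "x \<in> T closure_of D"
      using openin_subset[OF W(1)] \<open>x \<in> W\<close> dense by blast
    ultimately show "D \<inter> W \<noteq> {}" using W(1) by (auto simp: in_closure_of)
  qed
next
  assume "\<forall>W. openin T W \<longrightarrow> W \<noteq> {} \<longrightarrow> D \<inter> W \<noteq> {}"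
  then have "x \<in> T closure_of D" if "x \<in> topspace T" for x
    unfolding in_closure_of using that by blast
  then have "topspace T \<subseteq> T closure_of D" by (rule subsetI)
  then show "T closure_of D = topspace T"
    using closure_of_subset_topspace by (rule subset_antisym[rotated])
qed

text \<open>By regularity, the interiors of closures of open sets form a base, and the closure of an open set
  depends only on its trace on a countable dense set. There are at most continuum many such traces.\<close>
lemma regular_separable_base:
  assumes "regular_space T" "separable_space T"
  obtains U :: "real \<Rightarrow> 'a set" where "\<And>i. openin T (U i)"
    "\<And>W x. openin T W \<Longrightarrow> x \<in> W \<Longrightarrow> \<exists>i. x \<in> U i \<and> U i \<subseteq> W"
proof -
  obtain C where C: "countable C" "T closure_of C = topspace T"
    using assms(2) by (auto simp: separable_space_def)
  have "Pow C \<subseteq> (\<lambda>B. from_nat_into C ` B) ` (UNIV :: nat set set)"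
  proof
    fix B assume "B \<in> Pow C"
    then have "B = from_nat_into C ` {n. from_nat_into C n \<in> B}"
      using subset_range_from_nat_into[OF C(1)] by blast
    then show "B \<in> (\<lambda>B. from_nat_into C ` B) ` UNIV" by blast
  qed
  then have "Pow C \<lesssim> (UNIV :: nat set set)" by (rule subset_image_lepoll)
  then have "Pow C \<lesssim> (UNIV :: real set)"
    using nat_sets_eqpoll_reals by (rule lepoll_trans2)
  then obtain g :: "real \<Rightarrow> 'a set" where g: "Pow C \<subseteq> range g"
    by (auto simp: lepoll_iff)
  define U where "U i = T interior_of (T closure_of (g i))" for i
  have base: "\<exists>i. x \<in> U i \<and> U i \<subseteq> W" if W: "openin T W" and x: "x \<in> W" for W x
  proof -
    obtain V K where V: "openin T V" "closedin T K" "x \<in> V" "V \<subseteq> K" "K \<subseteq> W"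
      using assms(1)[folded neighbourhood_base_of_closedin, unfolded neighbourhood_base_of,
          rule_format, OF conjI[OF W x]] by blast
    have cl: "T closure_of (V \<inter> C) = T closure_of V"
      using V(1) C(2) openin_subset[OF V(1)] by (intro closure_of_openin_Int_superset) simp
    have "V \<inter> C \<in> range g" using g by blast
    then obtain i where i: "g i = V \<inter> C" by (metis imageE)
    have "V \<subseteq> T closure_of V" using openin_subset[OF V(1)] by (rule closure_of_subset)
    then have "V \<subseteq> U i" unfolding U_def i cl using V(1) by (rule interior_of_maximal)
    moreover have "U i \<subseteq> K"
      using interior_of_subset[of T "T closure_of V"] closure_of_minimal[OF V(4,2)]
      unfolding U_def i cl by blast
    ultimately show ?thesis using V by blast
  qed
  have "openin T (U i)" for i by (simp add: U_def)
  then show thesis using that[of U] base by blast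
qed

text \<open>A point of \<open>W\<close> is corrected for one prime \<open>p\<close> at a time. With \<open>N = p\<^sup>k m\<close> and \<open>m\<close> prime to \<open>p\<close>, it is
  moved by \<open>mz\<close> for \<open>z\<close> near the neutral element. Then \<open>(N/p)mz\<close> takes too many values for all the
  moved points to have their \<open>N/p\<close>-multiple in \<open>P\<close>, while \<open>(N/q)mz = 0\<close> for every other prime divisor
  \<open>q\<close> of \<open>N\<close>, so that earlier corrections survive.\<close>
lemma exists_generic_point_in_open:
  fixes N :: nat
  assumes "comm_group G" "paratopological_group G T" "separable_space T" "power_images_large G"
    and N: "N > 0" "\<And>g. g \<in> carrier G \<Longrightarrow> g [^]\<^bsub>G\<^esub> N = \<one>\<^bsub>G\<^esub>"
    and exp: "\<And>m. (\<And>g. g \<in> carrier G \<Longrightarrow> g [^]\<^bsub>G\<^esub> m = \<one>\<^bsub>G\<^esub>) \<Longrightarrow> N dvd m"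
    and W: "openin T W" "W \<noteq> {}" and P: "P \<prec> (UNIV :: real set)"
  shows "\<exists>x\<in>W. \<forall>p. prime p \<longrightarrow> p dvd N \<longrightarrow> x [^]\<^bsub>G\<^esub> (N div p) \<notin> P"
proof -
  interpret comm_group G by fact
  have top: "topspace T = carrier G" using assms(2) by (simp add: paratopological_group_def)
  have W_car: "W \<subseteq> carrier G" using openin_subset[OF W(1)] top by simp
  obtain C where C: "countable C" "C \<subseteq> carrier G" "T closure_of C = topspace T"
    using assms(3) top by (auto simp: separable_space_def)
  have C_meets: "C \<inter> A \<noteq> {}" if "openin T A" "A \<noteq> {}" for A
    using C(2,3) that dense_iff_meets_open[of C T] top by blast
  have "finite F \<Longrightarrow> F \<subseteq> {p. prime p \<and> p dvd N} \<Longrightarrow>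
      \<exists>x\<in>W. \<forall>p\<in>F. x [^]\<^bsub>G\<^esub> (N div p) \<notin> P" for F
  proof (induction F rule: finite_induct)
    case empty
    then show ?case using W(2) by blast
  next
    case (insert p F)
    then obtain x where x: "x \<in> W" "\<forall>q\<in>F. x [^]\<^bsub>G\<^esub> (N div q) \<notin> P" by blast
    have x_car: "x \<in> carrier G" using x(1) W_car by blast
    have p: "prime p" "p dvd N" using insert.prems by auto
    obtain m where m: "N = p ^ multiplicity p N * m" "\<not> p dvd m"
      using multiplicity_decompose'[of N p] N(1) p(1) by (metis not_prime_unit not_gr0)
    define V where "V = {z \<in> carrier G. x \<otimes>\<^bsub>G\<^esub> z [^]\<^bsub>G\<^esub> m \<in> W}"
    have "continuous_map T T (\<lambda>z. x \<otimes>\<^bsub>G\<^esub> z [^]\<^bsub>G\<^esub> m)"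
      using x_car top by (intro paratopological_group_continuous_mult[OF assms(2)]
          paratopological_group_continuous_pow[OF assms(2)]) auto
    then have V: "openin T V"
      using W(1) openin_continuous_map_preimage[of T T _ W] unfolding V_def top[symmetric] by blast
    have one_V: "\<one>\<^bsub>G\<^esub> \<in> V" using x(1) x_car by (simp add: V_def)
    have factor: "\<exists>c\<in>C. \<exists>w\<in>V. g = c \<otimes>\<^bsub>G\<^esub> w" if g: "g \<in> carrier G" for g
    proof -
      \<comment> \<open>The \<open>(N-1)\<close>-st power is the inverse, but its continuity follows from that of the
        multiplication.\<close>
      let ?A = "{c \<in> topspace T. c [^]\<^bsub>G\<^esub> (N - 1) \<otimes>\<^bsub>G\<^esub> g \<in> V}"
      have "continuous_map T T (\<lambda>c. c [^]\<^bsub>G\<^esub> (N - 1) \<otimes>\<^bsub>G\<^esub> g)"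
        using g top by (intro paratopological_group_continuous_mult[OF assms(2)]
            paratopological_group_continuous_pow[OF assms(2)]) auto
      then have "openin T ?A" using V by (rule openin_continuous_map_preimage)
      moreover have pow: "c [^]\<^bsub>G\<^esub> (N - 1) \<otimes>\<^bsub>G\<^esub> c = \<one>\<^bsub>G\<^esub>" if "c \<in> carrier G" for c
        using N(1) N(2)[OF that] nat_pow_Suc[of c "N - 1"] by simp
      then have "g \<in> ?A" using g one_V top by simp
      ultimately obtain c where c: "c \<in> C" "c \<in> ?A" using C_meets[of ?A] by blast
      have c_car: "c \<in> carrier G" using c(1) C(2) by blast
      have "c \<otimes>\<^bsub>G\<^esub> (c [^]\<^bsub>G\<^esub> (N - 1) \<otimes>\<^bsub>G\<^esub> g) = (c [^]\<^bsub>G\<^esub> (N - 1) \<otimes>\<^bsub>G\<^esub> c) \<otimes>\<^bsub>G\<^esub> g"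
        using c_car g by (simp add: m_assoc m_lcomm)
      also have "\<dots> = g" using pow[OF c_car] g by simp
      finally show ?thesis using c by force
    qed
    have "(UNIV :: real set) \<lesssim> (\<lambda>g. g [^]\<^bsub>G\<^esub> (N div p * m)) ` carrier G"
      using prime_quotient_power_image_large[OF assms(4) N(1) p m(2) exp] .
    moreover have "(\<lambda>y. inv\<^bsub>G\<^esub> (x [^]\<^bsub>G\<^esub> (N div p)) \<otimes>\<^bsub>G\<^esub> y) ` P \<prec> (UNIV :: real set)"
      using P by (rule image_lesspoll)
    moreover have "V \<subseteq> carrier G" by (auto simp: V_def)
    ultimately obtain z where z: "z \<in> V"
        "z [^]\<^bsub>G\<^esub> (N div p * m) \<notin> (\<lambda>y. inv\<^bsub>G\<^esub> (x [^]\<^bsub>G\<^esub> (N div p)) \<otimes>\<^bsub>G\<^esub> y) ` P"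
      using power_image_of_factor[OF C(2) _ countable_imp_lesspoll_reals[OF C(1)] factor] by blast
    have z_car: "z \<in> carrier G" using z(1) by (simp add: V_def)
    let ?x = "x \<otimes>\<^bsub>G\<^esub> z [^]\<^bsub>G\<^esub> m"
    have pow_x: "?x [^]\<^bsub>G\<^esub> i = x [^]\<^bsub>G\<^esub> i \<otimes>\<^bsub>G\<^esub> z [^]\<^bsub>G\<^esub> (i * m)" for i :: nat
      using x_car z_car by (simp add: nat_pow_distrib nat_pow_pow mult.commute)
    have "?x [^]\<^bsub>G\<^esub> (N div p) \<notin> P"
    proof
      assume "?x [^]\<^bsub>G\<^esub> (N div p) \<in> P"
      moreover have "z [^]\<^bsub>G\<^esub> (N div p * m) = inv\<^bsub>G\<^esub> (x [^]\<^bsub>G\<^esub> (N div p)) \<otimes>\<^bsub>G\<^esub> ?x [^]\<^bsub>G\<^esub> (N div p)"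
        unfolding pow_x using x_car z_car by (simp add: m_assoc[symmetric])
      ultimately show False using z(2) by blast
    qed
    moreover have "?x [^]\<^bsub>G\<^esub> (N div q) \<notin> P" if q: "q \<in> F" for q
    proof -
      have q': "prime q" "q dvd N" "q \<noteq> p" using q insert by auto
      have "coprime q (p ^ multiplicity p N)"
        using primes_coprime[OF q'(1) p(1) q'(3)] by simp
      then have "q dvd m" using q'(2) m(1) by (metis coprime_dvd_mult_right_iff)
      then have "N dvd N div q * m" using q'(2) by (metis dvd_div_mult_self dvd_refl mult_dvd_mono)
      then obtain l where "N div q * m = N * l" by blast
      then have "z [^]\<^bsub>G\<^esub> (N div q * m) = \<one>\<^bsub>G\<^esub>"
        using N(2)[OF z_car] z_car by (metis nat_pow_one nat_pow_pow)
      then show ?thesis using x(2) q x_car by (simp add: pow_x)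
    qed
    moreover have "?x \<in> W" using z(1) by (simp add: V_def)
    ultimately show ?case by blast
  qed
  moreover have "finite {p. prime p \<and> p dvd N}" using N(1) by simp
  ultimately show ?thesis by (metis (mono_tags, lifting) mem_Collect_eq subset_refl)
qed

text \<open>The independent family has one member in each basic open set, so the subgroup that it generates is
  dense; by independence over \<open>S\<close> this subgroup meets \<open>S\<close> trivially.\<close>
lemma power_images_large_imp_d_independent:
  assumes "comm_group G" "paratopological_group G T" "regular_space T"
    and "dense_subgroup_separable G T" "\<not> trivial_group G" "bounded_group G" "power_images_large G"
  shows "d_independent G T"
  unfolding d_independent_def
proof (intro conjI allI impI)
  interpret comm_group G by fact
  show "paratopological_group G T" "\<not> trivial_group G" by fact+
  fix S assume S: "subgroup S G \<and> S \<prec> (UNIV :: real set)"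
  have top: "topspace T = carrier G" using assms(2) by (simp add: paratopological_group_def)
  have "dense_subgroup G T (carrier G)"
    using subgroup_self closure_of_topspace[of T] by (simp add: dense_subgroup_def top)
  then have sep: "separable_space T"
    using assms(4) subtopology_topspace[of T] unfolding dense_subgroup_separable_def top by metis
  obtain U :: "real \<Rightarrow> 'a set" where U: "\<And>i. openin T (U i)"
    "\<And>W x. openin T W \<Longrightarrow> x \<in> W \<Longrightarrow> \<exists>i. x \<in> U i \<and> U i \<subseteq> W"
    using regular_separable_base[OF assms(3) sep] by blast
  \<comment> \<open>The indexing of the base may also hit the empty set, where no point can be chosen.\<close>
  define U' where "U' i = (if U i = {} then carrier G else U i)" for i
  have U': "openin T (U' i)" "U' i \<noteq> {}" for i
    using U(1) openin_topspace[of T] by (auto simp: U'_def top)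
  have U'_car: "U' i \<subseteq> carrier G" for i using openin_subset[OF U'(1)] top by simp
  obtain N :: nat where N: "N > 0" "\<And>g. g \<in> carrier G \<Longrightarrow> g [^]\<^bsub>G\<^esub> N = \<one>\<^bsub>G\<^esub>"
    and exp: "\<And>m. (\<And>g. g \<in> carrier G \<Longrightarrow> g [^]\<^bsub>G\<^esub> m = \<one>\<^bsub>G\<^esub>) \<Longrightarrow> N dvd m"
    using bounded_group_exponent[OF assms(6)] by blast
  have "\<exists>x\<in>U' i. x \<in> carrier G \<and> x [^]\<^bsub>G\<^esub> N = \<one>\<^bsub>G\<^esub> \<and>
      (\<forall>p. prime p \<longrightarrow> p dvd N \<longrightarrow> x [^]\<^bsub>G\<^esub> (N div p) \<notin> P)" if P: "P \<prec> (UNIV :: real set)" for i P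
    using exists_generic_point_in_open[OF assms(1,2) sep assms(7) N exp U' P] U'_car[of i] N(2)
    by blast
  then obtain f where f: "\<And>i. f i \<in> U' i" "\<And>i. f i \<in> carrier G" "\<And>i. f i [^]\<^bsub>G\<^esub> N = \<one>\<^bsub>G\<^esub>"
      "independent_over G S N f"
    using exists_independent_family[of S N U'] S N(1) by metis
  define L where "L = generate G (range f)"
  have L: "subgroup L G" unfolding L_def using f(2) by (intro generate_is_subgroup) auto
  have SL: "S \<inter> L = {\<one>\<^bsub>G\<^esub>}"
    unfolding L_def using S by (intro independent_generate_Int[OF f(4) _ f(2,3)]) blast
  have "L \<inter> W \<noteq> {}" if W: "openin T W" "W \<noteq> {}" for W
  proof -
    obtain x i where "x \<in> U i" "U i \<subseteq> W" using U(2)[OF W(1)] W(2) by blast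
    then have "f i \<in> W" using f(1)[of i] by (auto simp: U'_def split: if_splits)
    moreover have "f i \<in> L" unfolding L_def by (intro generate.incl) auto
    ultimately show ?thesis by blast
  qed
  moreover have L_car: "L \<subseteq> topspace T" using subgroup.subset[OF L] top by simp
  ultimately have L_dense: "T closure_of L = topspace T"
    using dense_iff_meets_open by blast
  then have "separable_space (subtopology T L)"
    using L assms(4) by (simp add: dense_subgroup_separable_def dense_subgroup_def)
  then obtain C where C: "countable C" "C \<subseteq> L" "subtopology T L closure_of C = L"
    using L_car unfolding separable_space_def by (auto simp: inf_absorb2)
  define D where "D = generate G C"
  have C_car: "C \<subseteq> carrier G" using C(2) L_car top by blast
  have D: "subgroup D G" "countable D"
    unfolding D_def using C_car C(1) by (auto intro: generate_is_subgroup countable_generate)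
  have CD: "C \<subseteq> D" unfolding D_def by (auto intro: generate.incl)
  have DL: "D \<subseteq> L" unfolding D_def using C(2) L by (rule generate_subgroup_incl)
  have "L \<inter> T closure_of C = L" using C(2,3) by (simp add: inf_absorb2 closure_of_subtopology)
  then have "L \<subseteq> T closure_of D" using closure_of_mono[OF CD] by blast
  then have "topspace T \<subseteq> T closure_of D"
    using closure_of_minimal[of L "T closure_of D" T] L_dense by simp
  then have "dense_subgroup G T D"
    using D(1) closure_of_subset_topspace[of T D] by (auto simp: dense_subgroup_def)
  moreover have "S \<inter> D = {\<one>\<^bsub>G\<^esub>}"
    using SL DL subgroup.one_closed[OF D(1)] by blast
  ultimately show "\<exists>H. dense_subgroup G T H \<and> countable H \<and> S \<inter> H = {\<one>\<^bsub>G\<^esub>}"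
    using D(2) by blast
qed

section \<open>Primary components\<close>

lemma paratopological_group_subgroup:
  assumes "paratopological_group G T" "subgroup H G"
  shows "paratopological_group (G\<lparr>carrier := H\<rparr>) (subtopology T H)"
proof -
  have G: "group G" and top: "topspace T = carrier G"
    and cont: "continuous_map (prod_topology T T) T (\<lambda>(x, y). x \<otimes>\<^bsub>G\<^esub> y)"
    using assms(1) by (auto simp: paratopological_group_def)
  have "topspace (subtopology T H) = H"
    using subgroup.subset[OF assms(2)] top by auto
  moreover have "continuous_map (prod_topology (subtopology T H) (subtopology T H)) (subtopology T H)
      (\<lambda>(x, y). x \<otimes>\<^bsub>G\<^esub> y)"
    using continuous_map_from_subtopology[OF cont, of "H \<times> H"] subgroup.m_closed[OF assms(2)]
    by (auto simp: continuous_map_in_subtopology subtopology_Times)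
  ultimately show ?thesis
    using subgroup.subgroup_is_group[OF assms(2) G] by (simp add: paratopological_group_def)
qed

lemma (in group) primary_component_eq_torsion:
  assumes "prime p" "\<not> p dvd r" "\<And>g. g \<in> carrier G \<Longrightarrow> g [^] (p ^ k * r) = \<one>"
  shows "primary_component G p = {g \<in> carrier G. g [^] (p ^ k) = \<one>}"
proof (intro equalityI subsetI)
  fix g assume "g \<in> primary_component G p"
  then obtain j where g: "g \<in> carrier G" "ord g = p ^ j"
    by (auto simp: primary_component_def)
  then have "p ^ j dvd p ^ k * r" using assms(3)[OF g(1)] by (simp add: pow_eq_id)
  moreover have "coprime (p ^ j) r" using assms(1,2) by (simp add: prime_imp_coprime)
  ultimately have "p ^ j dvd p ^ k" by (simp add: coprime_dvd_mult_left_iff)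
  then show "g \<in> {g \<in> carrier G. g [^] (p ^ k) = \<one>}" using g by (simp add: pow_eq_id)
next
  fix g assume "g \<in> {g \<in> carrier G. g [^] (p ^ k) = \<one>}"
  then have "g \<in> carrier G" "ord g dvd p ^ k" by (auto simp: pow_eq_id)
  then show "g \<in> primary_component G p"
    using divides_primepow_nat[OF assms(1)] by (auto simp: primary_component_def)
qed

text \<open>In a bounded group the orders of the elements of a primary component are bounded by one power of
  \<open>p\<close>, so the component consists of all elements that this power annihilates.\<close>
lemma (in group) primary_component_torsion:
  assumes "bounded_group G" "prime p"
  obtains k r where "\<not> p dvd r" "\<And>g. g \<in> carrier G \<Longrightarrow> g [^] (p ^ k * r) = \<one>"
    "primary_component G p = {g \<in> carrier G. g [^] (p ^ k) = \<one>}"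
proof -
  obtain N :: nat where N: "N > 0" "\<And>g. g \<in> carrier G \<Longrightarrow> g [^] N = \<one>"
    using bounded_group_exponent[OF assms(1)] by metis
  obtain r where r: "N = p ^ multiplicity p N * r" "\<not> p dvd r"
    using multiplicity_decompose'[of N p] N(1) assms(2) by (metis not_prime_unit not_gr0)
  have kill: "g [^] (p ^ multiplicity p N * r) = \<one>" if "g \<in> carrier G" for g
    using N(2)[OF that] r(1) by simp
  show thesis
    using that[OF r(2) kill primary_component_eq_torsion[OF assms(2) r(2) kill]] .
qed

text \<open>With \<open>N = p\<^sup>k r\<close> an annihilator of \<open>G\<close> and \<open>r\<close> prime to \<open>p\<close>, multiplication by \<open>r\<close> maps \<open>G\<close>
  continuously onto the \<open>p\<close>-primary component and every subgroup \<open>D\<close> into itself. So a dense \<open>D\<close> has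
  a dense intersection with the component.\<close>
lemma d_independent_primary_component:
  assumes "comm_group G" "bounded_group G" "d_independent G T" "prime p"
    and "\<not> trivial_group (G\<lparr>carrier := primary_component G p\<rparr>)"
  shows "d_independent (G\<lparr>carrier := primary_component G p\<rparr>)
    (subtopology T (primary_component G p))"
proof -
  interpret comm_group G by fact
  let ?P = "primary_component G p" and ?T = "subtopology T (primary_component G p)"
  have para: "paratopological_group G T" and top: "topspace T = carrier G"
    using assms(3) by (auto simp: d_independent_def paratopological_group_def)
  obtain k r where r: "\<not> p dvd r" "\<And>g. g \<in> carrier G \<Longrightarrow> g [^]\<^bsub>G\<^esub> (p ^ k * r) = \<one>\<^bsub>G\<^esub>"
    and P_eq: "?P = {g \<in> carrier G. g [^]\<^bsub>G\<^esub> (p ^ k) = \<one>\<^bsub>G\<^esub>}"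
    using primary_component_torsion[OF assms(2,4)] by metis
  have P: "subgroup ?P G" unfolding P_eq by (rule subgroup_torsion)
  have P_car: "?P \<subseteq> carrier G" using P by (rule subgroup.subset)
  have topP: "topspace ?T = ?P" using P_car top by auto
  have "coprime (int r) (int (p ^ k))"
    using r(1) assms(4) prime_imp_coprime coprime_commute by (metis coprime_int_iff coprime_power_right_iff)
  then obtain u v where uv: "u * int r + v * int (p ^ k) = 1"
    using bezout_int[of "int r" "int (p ^ k)"] by (auto simp: coprime_iff_gcd_eq_1)
  have "\<exists>H. dense_subgroup (G\<lparr>carrier := ?P\<rparr>) ?T H \<and> countable H \<and> S \<inter> H = {\<one>\<^bsub>G\<^esub>}"
    if S: "subgroup S (G\<lparr>carrier := ?P\<rparr>)" "S \<prec> (UNIV :: real set)" for S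
  proof -
    have SG: "subgroup S G" using P S(1) by (rule incl_subgroup)
    then obtain D where D: "dense_subgroup G T D" "countable D" "S \<inter> D = {\<one>\<^bsub>G\<^esub>}"
      using assms(3) S(2) unfolding d_independent_def by blast
    have DG: "subgroup D G" and D_dense: "T closure_of D = topspace T"
      using D(1) by (auto simp: dense_subgroup_def)
    have D_car: "D \<subseteq> topspace T" using subgroup.subset[OF DG] top by simp
    have "(D \<inter> ?P) \<inter> W \<noteq> {}" if W: "openin ?T W" "W \<noteq> {}" for W
    proof -
      obtain A where A: "openin T A" "W = A \<inter> ?P" using W(1) by (auto simp: openin_subtopology)
      obtain x where x: "x \<in> A" "x \<in> ?P" using W(2) A(2) by blast
      have x_car: "x \<in> carrier G" using x(2) P_car by blast
      let ?B = "{y \<in> topspace T. y [^]\<^bsub>G\<^esub> r \<in> A}"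
      have "openin T ?B"
        using A(1) by (intro openin_continuous_map_preimage[OF paratopological_group_continuous_pow[OF para]]) auto
      \<comment> \<open>Since \<open>ur\<close> is congruent to 1 modulo \<open>p\<^sup>k\<close>, multiplication by \<open>r\<close> takes \<open>ux\<close> to \<open>x\<close>.\<close>
      moreover have "x [^]\<^bsub>G\<^esub> u \<in> ?B"
      proof -
        have xk: "x [^]\<^bsub>G\<^esub> int (p ^ k) = \<one>\<^bsub>G\<^esub>"
          unfolding int_pow_int using x(2) P_eq by simp
        have "x = x [^]\<^bsub>G\<^esub> (u * int r + int (p ^ k) * v)" using uv x_car by (simp add: mult.commute)
        also have "\<dots> = (x [^]\<^bsub>G\<^esub> u) [^]\<^bsub>G\<^esub> int r \<otimes>\<^bsub>G\<^esub> (x [^]\<^bsub>G\<^esub> int (p ^ k)) [^]\<^bsub>G\<^esub> v"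
          using x_car by (simp only: int_pow_mult int_pow_pow)
        also have "\<dots> = (x [^]\<^bsub>G\<^esub> u) [^]\<^bsub>G\<^esub> r"
          unfolding xk using x_car by (simp add: int_pow_int)
        finally show ?thesis using x(1) x_car top by simp
      qed
      ultimately obtain d where d: "d \<in> D" "d [^]\<^bsub>G\<^esub> r \<in> A"
        using D_dense dense_iff_meets_open[OF D_car] by blast
      have d_car: "d \<in> carrier G" using d(1) D_car top by blast
      have "d [^]\<^bsub>G\<^esub> r \<in> D"
        using subgroup_int_pow_closed[OF DG d(1), of "int r"] by (simp add: int_pow_int)
      moreover have "d [^]\<^bsub>G\<^esub> r \<in> ?P"
        using r(2)[OF d_car] d_car by (simp add: P_eq nat_pow_pow mult.commute)
      ultimately show ?thesis using d(2) A(2) by blast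
    qed
    then have "?T closure_of (D \<inter> ?P) = topspace ?T"
      using dense_iff_meets_open[of "D \<inter> ?P" ?T] topP by blast
    moreover have "subgroup (D \<inter> ?P) (G\<lparr>carrier := ?P\<rparr>)"
      using subgroups_Inter_pair[OF DG P] P by (intro subgroup_incl) auto
    moreover have "S \<inter> (D \<inter> ?P) = {\<one>\<^bsub>G\<^esub>}"
      using D(3) subgroup.one_closed[OF P] by blast
    ultimately show ?thesis using D(2) by (intro exI[of _ "D \<inter> ?P"]) (simp add: dense_subgroup_def)
  qed
  then show ?thesis
    using paratopological_group_subgroup[OF para P] assms(5) by (simp add: d_independent_def)
qed

text \<open>If \<open>mg\<close> is nontrivial, some prime \<open>p\<close> divides its order; multiplying \<open>g\<close> by the part of the
  exponent that is prime to \<open>p\<close> gives an element of the \<open>p\<close>-primary component whose \<open>m\<close>-multiple is still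
  nontrivial. So \<open>mG\<close> contains a nontrivial, hence large, image from that component.\<close>
lemma primary_components_imp_power_images_large:
  assumes "comm_group G" "Hausdorff_space T" "bounded_group G"
    and comp: "\<And>p::nat. prime p \<Longrightarrow> \<not> trivial_group (G\<lparr>carrier := primary_component G p\<rparr>) \<Longrightarrow>
      d_independent (G\<lparr>carrier := primary_component G p\<rparr>) (subtopology T (primary_component G p))"
  shows "power_images_large G"
  unfolding power_images_large_def
proof (intro allI disj_imp[THEN iffD2] impI)
  interpret comm_group G by fact
  fix m :: nat
  assume "\<not> (\<forall>g\<in>carrier G. g [^]\<^bsub>G\<^esub> m = \<one>\<^bsub>G\<^esub>)"
  then obtain g where g: "g \<in> carrier G" "g [^]\<^bsub>G\<^esub> m \<noteq> \<one>\<^bsub>G\<^esub>" by blast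
  define y where "y = g [^]\<^bsub>G\<^esub> m"
  have y: "y \<in> carrier G" "y \<noteq> \<one>\<^bsub>G\<^esub>" using g by (simp_all add: y_def)
  then have "ord y \<noteq> 1" using ord_eq_1 by blast
  then obtain p where p: "prime p" "p dvd ord y" using prime_factor_nat by blast
  let ?P = "primary_component G p" and ?G = "G\<lparr>carrier := primary_component G p\<rparr>"
  obtain k r where r: "\<not> p dvd r" "\<And>g. g \<in> carrier G \<Longrightarrow> g [^]\<^bsub>G\<^esub> (p ^ k * r) = \<one>\<^bsub>G\<^esub>"
    and P_eq: "?P = {g \<in> carrier G. g [^]\<^bsub>G\<^esub> (p ^ k) = \<one>\<^bsub>G\<^esub>}"
    using primary_component_torsion[OF assms(3) p(1)] by metis
  have P: "subgroup ?P G" unfolding P_eq by (rule subgroup_torsion)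
  define x where "x = g [^]\<^bsub>G\<^esub> r"
  have x: "x \<in> ?P" using r(2)[OF g(1)] g(1) by (simp add: x_def P_eq nat_pow_pow mult.commute)
  have "x [^]\<^bsub>G\<^esub> m = y [^]\<^bsub>G\<^esub> r" using g(1) by (simp add: x_def y_def nat_pow_pow mult.commute)
  then have xm: "x [^]\<^bsub>G\<^esub> m \<noteq> \<one>\<^bsub>G\<^esub>"
    using r(1) p(2) pow_eq_id[OF y(1)] dvd_trans by auto
  then have "x \<noteq> \<one>\<^bsub>G\<^esub>" by auto
  then have "\<not> trivial_group ?G" using x by (auto simp: trivial_group_def)
  then have "d_independent ?G (subtopology T ?P)" using p(1) by (rule comp[rotated])
  moreover have "comm_group ?G"
    using subgroup.subgroup_is_group[OF P group_axioms] subgroup.mem_carrier[OF P] m_comm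
    by (intro group.group_comm_groupI) auto
  moreover have "Hausdorff_space (subtopology T ?P)" using assms(2) by (rule Hausdorff_space_subtopology)
  ultimately have "power_images_large ?G" by (intro d_independent_imp_power_images_large)
  then have "(UNIV :: real set) \<lesssim> (\<lambda>g. g [^]\<^bsub>G\<^esub> m) ` ?P"
    using x xm nat_pow_consistent[of _ m ?P] unfolding power_images_large_def by auto
  also have "\<dots> \<lesssim> (\<lambda>g. g [^]\<^bsub>G\<^esub> m) ` carrier G"
    using subgroup.subset[OF P] by (intro subset_imp_lepoll image_mono)
  finally show "(UNIV :: real set) \<lesssim> (\<lambda>g. g [^]\<^bsub>G\<^esub> m) ` carrier G" .
qed

section \<open>Equivalence of the three conditions\<close>

theorem theorem4p20:
  fixes G :: "('a, 'b) monoid_scheme" and T :: "'a topology"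
  assumes "comm_group G"
    and "paratopological_group G T"
    and "Hausdorff_space T"
    and "regular_space T"
    and "dense_subgroup_separable G T"
    and "\<not> trivial_group G"
    and "bounded_group G"
  shows "(d_independent G T \<longleftrightarrow> \<not> trivial_group G \<and> M_group G) \<and>
         (d_independent G T \<longleftrightarrow>
            (\<forall>p::nat. prime p \<and> \<not> trivial_group (G\<lparr>carrier := primary_component G p\<rparr>) \<longrightarrow>
               d_independent (G\<lparr>carrier := primary_component G p\<rparr>)
                 (subtopology T (primary_component G p))))"
proof -
  have large_iff: "d_independent G T \<longleftrightarrow> power_images_large G"
    using d_independent_imp_power_images_large[OF assms(1,3)]
      power_images_large_imp_d_independent[OF assms(1,2,4-7)] by blast
  have "power_images_large G \<longleftrightarrow> M_group G"
    using M_group_imp_power_images_large[OF assms(1)]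
      power_images_large_imp_M_group[OF assms(1,7)] by blast
  moreover have "d_independent G T \<longleftrightarrow>
      (\<forall>p::nat. prime p \<and> \<not> trivial_group (G\<lparr>carrier := primary_component G p\<rparr>) \<longrightarrow>
         d_independent (G\<lparr>carrier := primary_component G p\<rparr>)
           (subtopology T (primary_component G p)))" (is "_ \<longleftrightarrow> ?comps")
  proof
    assume "d_independent G T"
    then show ?comps
      using d_independent_primary_component[OF assms(1,7)] by blast
  next
    assume ?comps
    then show "d_independent G T"
      unfolding large_iff using primary_components_imp_power_images_large[OF assms(1,3,7)] by blast
  qed
  ultimately show ?thesis using large_iff assms(6) by blast
qed

end
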